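(* Let $U\subset\mathbb{C}$ be a domain, let $f_0:U\to\mathbb{C}$ be an analytic function with a Siegel point $z_0\in U$, and let $\{f_n:U\to\mathbb{C}\}_{n\in\mathbb{N}}$ be a sequence of analytic functions each having an attracting fixed point at $z_0$. Suppose that $f_n$ converges to $f_0$ uniformly on each compact subset of $U$ and that the following conditions hold: (i) there is $\Theta<\pi/2$ such that $\big|\arg\big(1-f_n'(z_0)/f_0'(z_0)\big)\big|<\Theta$ for all $n\in\mathbb{N}$; (ii) the functions $\big(f_n(z)-f_0(z)\big)/\big(f_n'(z_0)-f_0'(z_0)\big)$, $n\in\mathbb{N}$, are uniformly bounded on each compact subset of $U$. For $k\in\mathbb{N}\cup\{0\}$ let $\varphi_k$ denote the Kœnigs function associated with the pair $(z_0,f_k)$. Then $\varphi_n$ converges to $\varphi_0$ uniformly on each compact subset of $\mathcal{A}^*(z_0,f_0,U)$ as $n\to\infty$; that is, for every compact $K\subset\mathcal{A}^*(z_0,f_0,U)$, the inclusion $K\subset\mathcal{A}^*(z_0,f_n,U)$ holds for all but finitely many $n$, and $\varphi_n\to\varphi_0$ uniformly on $K$.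
   Context: Here $\mathbb{N}=\{1,2,\dots\}$, and $\arg$ is the principal argument. Iterates. For a domain $U\subset\mathbb{C}$ and an analytic function $f:U\to\mathbb{C}$, the iterates are defined by $f^0=\mathrm{id}_U$, $f^1=f$ and $f^{n+1}:(f^n)^{-1}(U)\to\mathbb{C}$, $f^{n+1}:=f\circ f^n$. Put $E(f,U):=\bigcap_{n\in\mathbb{N}}(f^n)^{-1}(U)$. Fatou set. The Fatou set $\mathcal{F}(f,U)$ is the set of all interior points $z$ of $E(f,U)$ such that $\{f^n\}_{n\in\mathbb{N}}$ is a normal family (as maps into the Riemann sphere) in some neighbourhood of $z$. Fixed points. Let $z_0\in U$ be a fixed point of $f$ with multiplier $\lambda=f'(z_0)$. It is attracting if $|\lambda|<1$ (geometrically attracting if in addition $\lambda\neq0$) and neutral if $|\lambda|=1$. If $z_0$ is neutral and no $f^n$, $n\in\mathbb{N}$, is the identity map, then $z_0$ is parabolic if $\lambda=e^{2\pi i\alpha}$ with $\alpha\in\mathbb{Q}$, and irrationally neutral otherwise. An irrationally neutral fixed point that belongs to $\mathcal{F}(f,U)$ is called a Siegel point. Immediate basin. For a fixed point $z_0\in\mathcal{F}(f,U)$, the immediate basin $\mathcal{A}^*(z_0,f,U)$ is the connected component of $\mathcal{F}(f,U)$ containing $z_0$. Kœnigs function. If $z_0$ is a geometrically attracting or Siegel fixed point of $f$, the Kœnigs function $\varphi$ associated with $(z_0,f)$ is the solution, analytic in a neighbourhood of $z_0$, of the Schröder equation $\varphi(f(z))=\lambda\varphi(z)$, $\lambda:=f'(z_0)$,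 normalized by $\varphi'(z_0)=1$. It is known that it exists, is unique, and extends analytically to all of $\mathcal{A}^*(z_0,f,U)$; $\varphi$ denotes this extension. Since $f_n'(z_0)\to f_0'(z_0)\neq0$, the function $\varphi_n$ is defined for all but finitely many $n$, which is all that the statement concerns. *)

theory Defs
  imports "HOL-Complex_Analysis.Complex_Analysis"
begin

text \<open>
  A map \<open>f : U \<rightarrow> \<complex>\<close> is a total HOL function of which only the values on \<open>U\<close> matter.
  \<open>iter_dom f U n\<close> is the domain of the partial iterate \<open>f\<^sup>n\<close>: it is \<open>U\<close> for \<open>n = 0\<close> and
  the preimage of \<open>U\<close> under the partial map \<open>f\<^sup>n\<close> for \<open>n + 1\<close>.
  On \<open>iter_dom f U n\<close> the partial iterate is \<open>f ^^ n\<close>.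
\<close>

primrec iter_dom :: "(complex \<Rightarrow> complex) \<Rightarrow> complex set \<Rightarrow> nat \<Rightarrow> complex set" where
  "iter_dom f U 0 = U"
| "iter_dom f U (Suc n) = {z \<in> iter_dom f U n. (f ^^ n) z \<in> U}"

definition escape_free :: "(complex \<Rightarrow> complex) \<Rightarrow> complex set \<Rightarrow> complex set" where
  "escape_free f U = (\<Inter>n\<in>{1..}. iter_dom f U (Suc n))"

lemma iter_dom_Suc_iff: "z \<in> iter_dom f U (Suc n) \<longleftrightarrow> (\<forall>k\<le>n. (f ^^ k) z \<in> U)"
  by (induction n) (auto simp: le_Suc_eq)

lemma escape_free_iff: "z \<in> escape_free f U \<longleftrightarrow> (\<forall>n. (f ^^ n) z \<in> U)"
  unfolding escape_free_def INT_iff iter_dom_Suc_iff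
  by (metis atLeast_iff le_add2 le_add1)

text \<open>
  The Riemann sphere is the unit sphere of \<open>\<complex> \<times> \<real>\<close>, with \<open>\<infinity>\<close> the north pole \<open>(0, 1)\<close>;
  the Euclidean distance restricts to the chordal distance.
\<close>

definition riemann_sphere :: "(complex \<times> real) set" where
  "riemann_sphere = sphere 0 1"

definition to_sphere :: "complex \<Rightarrow> complex \<times> real" where
  "to_sphere z = (2 * z / of_real (1 + (cmod z)\<^sup>2), ((cmod z)\<^sup>2 - 1) / ((cmod z)\<^sup>2 + 1))"

lemma to_sphere_in_riemann_sphere: "to_sphere z \<in> riemann_sphere"
proof -
  define r where "r = (cmod z)\<^sup>2"
  have r: "r \<ge> 0" by (simp add: r_def)
  have "cmod (2 * z / of_real (1 + r)) = 2 * cmod z / (1 + r)"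
    using r by (simp only: norm_divide norm_mult norm_of_real norm_numeral)
  hence "(cmod (2 * z / of_real (1 + r)))\<^sup>2 = 4 * r / (1 + r)\<^sup>2"
    by (simp add: power_divide power_mult_distrib r_def)
  moreover have "4 * r / (1 + r)\<^sup>2 + ((r - 1) / (r + 1))\<^sup>2 = (4 * r + (r - 1)\<^sup>2) / (1 + r)\<^sup>2"
    by (simp add: power_divide add_divide_distrib add.commute)
  moreover have "4 * r + (r - 1)\<^sup>2 = (1 + r)\<^sup>2"
    by (simp add: power2_eq_square algebra_simps)
  ultimately show ?thesis
    using r by (simp add: riemann_sphere_def to_sphere_def norm_Pair power_divide flip: r_def)
qed

definition normal_family_on :: "(complex \<Rightarrow> complex) set \<Rightarrow> complex set \<Rightarrow> bool" where
  "normal_family_on F V \<longleftrightarrow>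
     (\<forall>h :: nat \<Rightarrow> complex \<Rightarrow> complex. range h \<subseteq> F \<longrightarrow>
        (\<exists>(r :: nat \<Rightarrow> nat) g. strict_mono r \<and> g ` V \<subseteq> riemann_sphere \<and>
           (\<forall>K. compact K \<and> K \<subseteq> V \<longrightarrow>
              uniform_limit K (\<lambda>n z. to_sphere (h (r n) z)) g sequentially)))"

definition fatou_set :: "(complex \<Rightarrow> complex) \<Rightarrow> complex set \<Rightarrow> complex set" where
  "fatou_set f U =
     {z \<in> interior (escape_free f U).
        \<exists>V. open V \<and> z \<in> V \<and> V \<subseteq> escape_free f U \<and>
            normal_family_on ((\<lambda>n. f ^^ n) ` {1..}) V}"

definition fixed_point :: "(complex \<Rightarrow> complex) \<Rightarrow> complex set \<Rightarrow> complex \<Rightarrow> bool" where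
  "fixed_point f U z0 \<longleftrightarrow> z0 \<in> U \<and> f z0 = z0"

definition attracting :: "(complex \<Rightarrow> complex) \<Rightarrow> complex set \<Rightarrow> complex \<Rightarrow> bool" where
  "attracting f U z0 \<longleftrightarrow> fixed_point f U z0 \<and> cmod (deriv f z0) < 1"

definition geometrically_attracting ::
    "(complex \<Rightarrow> complex) \<Rightarrow> complex set \<Rightarrow> complex \<Rightarrow> bool" where
  "geometrically_attracting f U z0 \<longleftrightarrow> attracting f U z0 \<and> deriv f z0 \<noteq> 0"

definition neutral :: "(complex \<Rightarrow> complex) \<Rightarrow> complex set \<Rightarrow> complex \<Rightarrow> bool" where
  "neutral f U z0 \<longleftrightarrow> fixed_point f U z0 \<and> cmod (deriv f z0) = 1"

definition no_identity_iterate :: "(complex \<Rightarrow> complex) \<Rightarrow> complex set \<Rightarrow> bool" where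
  "no_identity_iterate f U \<longleftrightarrow> (\<forall>n\<ge>1. \<not> (\<forall>z\<in>iter_dom f U n. (f ^^ n) z = z))"

definition parabolic :: "(complex \<Rightarrow> complex) \<Rightarrow> complex set \<Rightarrow> complex \<Rightarrow> bool" where
  "parabolic f U z0 \<longleftrightarrow> neutral f U z0 \<and> no_identity_iterate f U \<and>
     (\<exists>\<alpha>\<in>\<rat>. deriv f z0 = cis (2 * pi * \<alpha>))"

definition irrationally_neutral ::
    "(complex \<Rightarrow> complex) \<Rightarrow> complex set \<Rightarrow> complex \<Rightarrow> bool" where
  "irrationally_neutral f U z0 \<longleftrightarrow>
     neutral f U z0 \<and> no_identity_iterate f U \<and> \<not> parabolic f U z0"

definition siegel_point :: "(complex \<Rightarrow> complex) \<Rightarrow> complex set \<Rightarrow> complex \<Rightarrow> bool" where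
  "siegel_point f U z0 \<longleftrightarrow> irrationally_neutral f U z0 \<and> z0 \<in> fatou_set f U"

definition immediate_basin ::
    "complex \<Rightarrow> (complex \<Rightarrow> complex) \<Rightarrow> complex set \<Rightarrow> complex set" where
  "immediate_basin z0 f U = connected_component_set (fatou_set f U) z0"

text \<open>
  The Koenigs function of a geometrically attracting or Siegel fixed point, extended to the
  immediate basin. As the basin is open and connected, its values there are determined by the
  normalized solution of the Schroeder equation near \<open>z0\<close>; values outside are irrelevant.
\<close>

definition is_koenigs_function ::
    "(complex \<Rightarrow> complex) \<Rightarrow> complex set \<Rightarrow> complex \<Rightarrow> (complex \<Rightarrow> complex) \<Rightarrow> bool" where
  "is_koenigs_function f U z0 \<phi> \<longleftrightarrow>
     (geometrically_attracting f U z0 \<or> siegel_point f U z0) \<and>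
     \<phi> holomorphic_on immediate_basin z0 f U \<and>
     (\<forall>\<^sub>F z in nhds z0. \<phi> (f z) = deriv f z0 * \<phi> z) \<and>
     deriv \<phi> z0 = 1"

end

theory Submission
  imports Defs
begin

text \<open>
  Write \<open>l = f\<^sub>0'(z\<^sub>0)\<close>, \<open>S\<close> for the immediate basin of the Siegel point, and \<open>\<mu>\<close> for the multiplier of
  a nearby map \<open>F = f\<^sub>n\<close>. There are two parts: a global description of \<open>S\<close>, and a perturbation
  argument in the resulting coordinate.

  \<^bold>\<open>The basin is a round disc.\<close> The Koenigs function \<open>\<phi> = \<phi>\<^sub>0\<close> maps \<open>S\<close> conformally onto a disc
  (or onto the plane). The iterates of \<open>f\<^sub>0\<close> are locally bounded on \<open>S\<close>, and by Hurwitz' theorem the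
  closure of the forward orbit of a compact subset of \<open>S\<close> stays in \<open>S\<close>. Let \<open>\<Sum> b\<^sub>k w\<^sup>k\<close> be the germ of
  \<open>\<phi>\<^sup>-\<^sup>1\<close> at \<open>0\<close>. The Cesaro means of \<open>l\<^sup>-\<^sup>j\<^sup>k f\<^sub>0\<^sup>j\<close> over \<open>j\<close> extract the \<open>k\<close>-th term: they converge to
  \<open>b\<^sub>k \<phi>\<^sup>k\<close> near \<open>z\<^sub>0\<close>, hence on all of \<open>S\<close>. Being means of points of an orbit, they show that
  \<open>\<bar>b\<^sub>k\<bar> \<bar>\<phi>(z)\<bar>\<^sup>k\<close> is bounded in \<open>k\<close> for every \<open>z\<close> in \<open>S\<close>. So the series of \<open>\<phi>\<^sup>-\<^sup>1\<close> converges on the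
  smallest disc that contains \<open>\<phi>(S)\<close>, and it inverts \<open>\<phi>\<close> on \<open>S\<close> by analytic continuation. That
  \<open>\<phi>(S)\<close> fills this disc follows from the density of the powers of \<open>l\<close> in the unit circle.

  \<^bold>\<open>Perturbing the rotation.\<close> In the coordinate \<open>w = \<phi>(z)\<close> the map \<open>F\<close> becomes
  \<open>g(w) = \<mu> w + (\<mu> - l) H(w)\<close>, where \<open>H\<close> vanishes to second order at \<open>0\<close> and is bounded because
  the difference quotients \<open>(f\<^sub>n - f\<^sub>0) / (\<mu> - l)\<close> are. The angle condition gives
  \<open>\<bar>\<mu>\<bar> \<le> 1 - c \<bar>\<mu> - l\<bar>\<close>. Thus \<open>g\<close> contracts at a rate proportional
  to \<open>\<bar>\<mu> - l\<bar>\<close>, which is the size of the nonlinear term too; the contraction wins because the rotation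
  averages the nonlinear term out. Concretely, finitely many Taylor coefficients of \<open>H\<close> are removed by
  a polynomial change of coordinates \<open>\<psi>(w) = w + (\<mu> - l) q(w)\<close>, which only involves
  the finitely many divisors \<open>l - l\<^sup>k\<close>, \<open>2 \<le> k < N\<close>. What is left satisfies
  \<open>\<bar>\<psi>(g(w)) - \<mu> \<psi>(w)\<bar> \<le> \<delta> \<bar>\<mu> - l\<bar> \<bar>w\<bar>\<^sup>2\<close> with \<open>\<delta>\<close> as small as desired
  (\<open>approximate_linearization\<close>). Hence \<open>\<bar>\<psi>\<bar>\<close> decreases geometrically along orbits, and the relative errors
  of the Schroeder equation add up to \<open>O(\<delta>)\<close> along an orbit, uniformly in \<open>F\<close>. Therefore every normalized
  solution of the Schroeder equation for \<open>g\<close> is within \<open>O(\<delta>)\<close> of \<open>\<psi>\<close>, and so close to the identity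
  (\<open>perturbed_rotation\<close>). Transported back by \<open>\<phi>\<close>, this says that a given compact subset of \<open>S\<close> lies in
  the basin of \<open>F\<close> and that the Koenigs function of \<open>F\<close> is close to \<open>\<phi>\<close> there (\<open>nearby_koenigs\<close>).
\<close>

section \<open>Irrational rotations of the circle\<close>

lemma eq_cis_Arg:
  assumes "cmod z = 1"
  shows "z = cis (Arg z)"
proof -
  have "z \<noteq> 0" using assms by auto
  thus ?thesis using cis_Arg[of z] assms by (simp add: sgn_eq)
qed

lemma cis_rational_if_power_eq_1:
  assumes "cmod l = 1" "k \<ge> 1" "l ^ k = 1"
  shows "\<exists>\<alpha>\<in>\<rat>. l = cis (2 * pi * \<alpha>)"
proof -
  define t where "t = Arg l"
  have l: "l = cis t"
    using eq_cis_Arg[OF assms(1)] by (simp add: t_def)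
  have "cis (real k * t) = 1"
    using assms(3) unfolding l by (simp add: Complex.DeMoivre)
  hence "cos (real k * t) = 1"
    by (simp add: complex_eq_iff)
  then obtain n :: int where n: "real k * t = of_int n * 2 * pi"
    using cos_one_2pi_int by auto
  define \<alpha> where "\<alpha> = of_int n / (of_nat k :: real)"
  have "t = 2 * pi * \<alpha>"
    using n assms(2) by (simp add: \<alpha>_def field_simps)
  moreover have "\<alpha> \<in> \<rat>"
    by (simp add: \<alpha>_def)
  ultimately show ?thesis using l by auto
qed

lemma irrational_rotation_dense:
  assumes l: "cmod l = 1" and irr: "\<And>k. k \<ge> 1 \<Longrightarrow> l ^ k \<noteq> 1"
      and w: "cmod w = 1" and e: "e > 0"
  shows "\<exists>j. cmod (l ^ j - w) < e"
proof -
  define \<alpha> where "\<alpha> = Arg l / (2 * pi)"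
  define \<beta> where "\<beta> = Arg w / (2 * pi)"
  have l': "l = cis (2 * pi * \<alpha>)" and w': "w = cis (2 * pi * \<beta>)"
    using eq_cis_Arg[OF l] eq_cis_Arg[OF w] by (simp_all add: \<alpha>_def \<beta>_def)
  have "\<alpha> \<notin> \<rat>"
  proof
    assume "\<alpha> \<in> \<rat>"
    then obtain m :: int and n :: nat where mn: "n \<noteq> 0" "\<alpha> = of_int m / real n"
      unfolding Rats_eq_int_div_nat by blast
    have "l ^ n = cis (real n * (2 * pi * \<alpha>))"
      unfolding l' by (simp add: Complex.DeMoivre)
    also have "real n * (2 * pi * \<alpha>) = 2 * pi * of_int m"
      using mn by simp
    also have "cis \<dots> = 1"
      by (rule cis_multiple_2pi) simp
    finally show False using irr[of n] mn by simp
  qed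
  moreover have "e / 8 > 0" using e by simp
  ultimately obtain h k :: int where hk: "k > 0" "\<bar>of_int k * \<alpha> - of_int h - \<beta>\<bar> < e / 8"
    using sequence_of_fractional_parts_is_dense[of \<alpha> "e / 8" \<beta>] by blast
  define x where "x = of_int k * \<alpha> - of_int h - \<beta>"
  have "l ^ nat k = cis (real (nat k) * (2 * pi * \<alpha>))"
    unfolding l' by (simp add: Complex.DeMoivre)
  also have "real (nat k) = of_int k" using hk by simp
  also have "of_int k * (2 * pi * \<alpha>) = 2 * pi * \<beta> + 2 * pi * of_int h + 2 * pi * x"
    by (simp add: x_def algebra_simps)
  also have "cis \<dots> = w * cis (2 * pi * x)"
    unfolding w' by (simp add: cis_multiple_2pi flip: cis_mult)
  finally have "l ^ nat k - w = w * (cis (2 * pi * x) - 1)"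
    by (simp add: algebra_simps)
  hence "cmod (l ^ nat k - w) = cmod (cis (2 * pi * x) - 1)"
    using w by (simp add: norm_mult)
  also have "\<dots> \<le> \<bar>2 * pi * x\<bar>"
    using abs_sin_x_le_abs_x[of "pi * x"] dist_exp_i_1[of "2 * pi * x"]
    by (simp add: cis_conv_exp abs_mult)
  also have "\<dots> \<le> 8 * \<bar>x\<bar>"
    using mult_right_mono[of "2 * pi" 8 "\<bar>x\<bar>"] pi_less_4 by (simp add: abs_mult)
  also have "\<dots> < e" using hk by (simp add: x_def)
  finally show ?thesis by blast
qed

section \<open>Small perturbations of an irrational rotation\<close>

lemma norm_power_diff_le:
  fixes u v :: "'a::real_normed_field"
  assumes "norm u \<le> B" "norm v \<le> B"
  shows "norm (u ^ k - v ^ k) \<le> real k * B ^ (k - 1) * norm (u - v)"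
proof (cases k)
  case (Suc n)
  have "0 \<le> B" using assms(1) norm_ge_zero order_trans by blast
  have "norm (\<Sum>p<k. u ^ p * v ^ (n - p)) \<le> (\<Sum>p<k. B ^ n)"
  proof (rule sum_norm_le)
    fix p assume p: "p \<in> {..<k}"
    have "norm (u ^ p * v ^ (n - p)) \<le> B ^ p * B ^ (n - p)"
      unfolding norm_mult norm_power using assms \<open>0 \<le> B\<close>
      by (intro mult_mono power_mono) auto
    also have "\<dots> = B ^ n" using p Suc by (simp flip: power_add)
    finally show "norm (u ^ p * v ^ (n - p)) \<le> B ^ n" .
  qed
  moreover have "norm (u ^ k - v ^ k) = norm (u - v) * norm (\<Sum>p<k. u ^ p * v ^ (n - p))"
    unfolding Suc diff_power_eq_sum norm_mult by simp
  ultimately have "norm (u ^ k - v ^ k) \<le> norm (u - v) * (\<Sum>p<k. B ^ n)"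
    by (simp only: mult_left_mono norm_ge_zero)
  thus ?thesis using Suc by (simp add: algebra_simps)
qed auto

text \<open>
  Cauchy's inequality on circles of radius \<open>t < r\<close>, followed by the limit \<open>t \<longlongrightarrow> r\<close>.
\<close>

lemma Taylor_coeff_bound:
  assumes hol: "F holomorphic_on ball 0 r" and r: "r > 0"
      and B: "\<And>w. w \<in> ball 0 r \<Longrightarrow> cmod (F w) \<le> B"
  shows "cmod ((deriv ^^ k) F 0 / fact k) * r ^ k \<le> B"
proof -
  have *: "cmod ((deriv ^^ k) F 0 / fact k) * t ^ k \<le> B" if t: "0 < t" "t < r" for t
  proof -
    have "cmod ((deriv ^^ k) F 0) \<le> fact k * B / t ^ k"
      by (rule Cauchy_inequality)
         (use t hol B in \<open>auto intro!: holomorphic_on_subset[OF hol]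
            holomorphic_on_imp_continuous_on\<close>)
    thus ?thesis using t by (simp add: norm_divide field_simps)
  qed
  have "((\<lambda>t. cmod ((deriv ^^ k) F 0 / fact k) * t ^ k) \<longlongrightarrow>
          cmod ((deriv ^^ k) F 0 / fact k) * r ^ k) (at_left r)"
    by (intro tendsto_intros)
  moreover have "eventually (\<lambda>t. cmod ((deriv ^^ k) F 0 / fact k) * t ^ k \<le> B) (at_left r)"
    unfolding eventually_at_left_field using r * by (intro exI[of _ 0]) auto
  ultimately show ?thesis
    by (rule tendsto_upperbound) auto
qed

text \<open>
  The tail is dominated by a geometric series of ratio \<open>\<bar>w\<bar> / r\<close>. With large \<open>N\<close> this makes truncation
  errors small; with \<open>N = 2\<close> it is a Schwarz lemma for functions with a double zero at \<open>0\<close>.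
\<close>

lemma Taylor_tail_bound:
  assumes hol: "F holomorphic_on ball 0 r" and r: "0 < r"
      and B: "\<And>w. w \<in> ball 0 r \<Longrightarrow> cmod (F w) \<le> B" and s: "s < r"
      and w: "cmod w \<le> s"
  shows "cmod (F w - (\<Sum>k<N. (deriv ^^ k) F 0 / fact k * w ^ k)) \<le> B * (cmod w / r) ^ N / (1 - s / r)"
proof -
  define a where "a = (\<lambda>k. (deriv ^^ k) F 0 / fact k)"
  define x where "x = cmod w / r"
  have B0: "0 \<le> B" using order_trans[OF norm_ge_zero B[of 0]] r by simp
  have x: "0 \<le> x" "x \<le> s / r" "s / r < 1" using w r s by (auto simp: x_def field_simps)
  have "(\<lambda>k. a k * (w - 0) ^ k) sums F w"
    unfolding a_def by (rule holomorphic_power_series[OF hol]) (use w s in auto)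
  hence sums: "(\<lambda>k. a k * w ^ k) sums F w" by simp
  have le: "cmod (a k * w ^ k) \<le> B * x ^ k" for k
  proof -
    have "cmod (a k * w ^ k) = (cmod (a k) * r ^ k) * x ^ k"
      using r by (simp add: norm_mult norm_power x_def power_divide)
    also have "\<dots> \<le> B * x ^ k"
      using Taylor_coeff_bound[OF hol r B] x by (intro mult_right_mono) (auto simp: a_def)
    finally show ?thesis .
  qed
  have tail: "(\<lambda>k. a (k + N) * w ^ (k + N)) sums (F w - (\<Sum>k<N. a k * w ^ k))"
    using sums_split_initial_segment[OF sums] by simp
  have geo: "(\<lambda>k. B * x ^ N * x ^ k) sums (B * x ^ N * (1 / (1 - x)))"
    using x by (intro sums_mult geometric_sums) auto
  have "cmod (F w - (\<Sum>k<N. a k * w ^ k)) \<le> B * x ^ N * (1 / (1 - x))"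
  proof -
    have "cmod (\<Sum>k. a (k + N) * w ^ (k + N)) \<le> (\<Sum>k. B * x ^ N * x ^ k)"
      by (rule norm_suminf_le)
         (use le[of "_ + N"] geo in \<open>auto simp: power_add mult_ac sums_iff\<close>)
    thus ?thesis using tail geo by (simp add: sums_iff)
  qed
  also have "\<dots> \<le> B * x ^ N * (1 / (1 - s / r))"
    using x B0 by (intro mult_left_mono divide_left_mono) auto
  finally show ?thesis by (simp add: a_def x_def)
qed

text \<open>
  Write \<open>g(w) = \<mu> w + (\<mu> - l) H(w)\<close> with \<open>H(w) = O(w\<^sup>2)\<close>. For \<open>\<psi>(w) = w + (\<mu> - l) q(w)\<close> the defect
  \<open>\<psi>(g(w)) - \<mu> \<psi>(w)\<close> equals \<open>(\<mu> - l) E(w)\<close> with \<open>E = H + q \<circ> g - \<mu> q\<close>, which up to \<open>O(\<mu> - l)\<close> is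
  \<open>H(w) + q(l w) - l q(w)\<close>. The polynomial \<open>q\<close> is chosen to cancel the Taylor coefficients of \<open>H\<close> below
  \<open>N\<close>. This needs only the divisors \<open>l - l\<^sup>k\<close> with \<open>2 \<le> k < N\<close>. As they may be small, \<open>N\<close> is fixed first and the
  admissible size \<open>\<epsilon>0\<close> of \<open>\<bar>\<mu> - l\<bar>\<close> afterwards. Since \<open>E\<close> has a double zero, its smallness on the
  middle ball yields the factor \<open>\<bar>w\<bar>\<^sup>2\<close> on the inner one; this factor is what makes the errors
  summable along an orbit.
\<close>

lemma approximate_linearization:
  fixes l :: complex and s t r M \<delta> :: real
  assumes l: "cmod l = 1" and irr: "\<And>k. k \<ge> 1 \<Longrightarrow> l ^ k \<noteq> 1"
      and st: "0 < s" "s < t" "t < r" and M: "M > 0" and \<delta>: "\<delta> > 0"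
  obtains \<epsilon>0 Q where "\<epsilon>0 > 0" "Q \<ge> 0"
    "\<And>g \<mu>. g holomorphic_on ball 0 r \<Longrightarrow> g 0 = 0 \<Longrightarrow> deriv g 0 = \<mu> \<Longrightarrow> \<mu> \<noteq> l \<Longrightarrow>
       cmod (\<mu> - l) < \<epsilon>0 \<Longrightarrow>
       (\<And>w. w \<in> ball 0 r \<Longrightarrow> cmod (g w - l * w) \<le> M * cmod (\<mu> - l)) \<Longrightarrow>
       \<exists>\<psi>. (\<forall>w\<in>cball 0 t. cmod (\<psi> w - w) \<le> cmod (\<mu> - l) * Q * cmod w ^ 2) \<and>
           (\<forall>w\<in>cball 0 s. cmod (\<psi> (g w) - \<mu> * \<psi> w) \<le> cmod (\<mu> - l) * \<delta> * cmod w ^ 2)"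
proof -
  have r: "r > 0" using st by linarith
  define M' where "M' = M + r"
  have M': "M' > 0" using M r by (simp add: M'_def)
  \<comment> \<open>A bound \<open>\<delta>'\<close> for \<open>E\<close> on the ball of radius \<open>t\<close> gives \<open>\<delta> \<bar>w\<bar>\<^sup>2\<close> on the ball of radius \<open>s\<close>.\<close>
  define \<delta>' where "\<delta>' = \<delta> * t\<^sup>2 * (1 - s / t)"
  have \<delta>': "\<delta>' > 0" using st \<delta> by (simp add: \<delta>'_def)
  have "(\<lambda>N. M' * (t / r) ^ N / (1 - t / r)) \<longlonglongrightarrow> M' * 0 / (1 - t / r)"
    using st by (intro tendsto_intros LIMSEQ_power_zero) (auto simp: field_simps)
  hence "eventually (\<lambda>N. M' * (t / r) ^ N / (1 - t / r) < \<delta>' / 2) sequentially"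
    using \<delta>' by (intro order_tendstoD) auto
  then obtain N where N: "M' * (t / r) ^ N / (1 - t / r) < \<delta>' / 2" "N \<ge> 2"
    using eventually_ge_at_top[of 2] eventually_happens'[OF sequentially_bot]
    by (metis (mono_tags, lifting) eventually_conj)
  define C where "C = (\<lambda>k. M' / r ^ k / cmod (l - l ^ k))"
  have C: "C k \<ge> 0" for k using M' r by (simp add: C_def)
  define Q where "Q = (\<Sum>k=2..<N. C k * t ^ (k - 2))"
  have Q: "Q \<ge> 0" unfolding Q_def using C st by (intro sum_nonneg mult_nonneg_nonneg) auto
  define Lip where "Lip = (\<Sum>k=2..<N. C k * (real k * r ^ (k - 1)))"
  have Lip: "Lip \<ge> 0" unfolding Lip_def using C st by (intro sum_nonneg mult_nonneg_nonneg) auto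
  define D where "D = Lip * M + Q * t\<^sup>2 + 1"
  have D: "D > 0" using Lip M Q unfolding D_def by (meson add_nonneg_pos mult_nonneg_nonneg add_nonneg_nonneg less_imp_le zero_le_power2 zero_less_one)
  define \<epsilon>0 where "\<epsilon>0 = min ((r - t) / (M + 1)) (\<delta>' / (2 * D))"
  have \<epsilon>0: "\<epsilon>0 > 0" using st M D \<delta>' by (simp add: \<epsilon>0_def)
  show ?thesis
  proof (rule that[OF \<epsilon>0 Q])
    fix g \<mu>
    assume hol: "g holomorphic_on ball 0 r" and g0: "g 0 = 0" and dg: "deriv g 0 = \<mu>"
      and ne: "\<mu> \<noteq> l" and small: "cmod (\<mu> - l) < \<epsilon>0"
      and bd: "\<And>w. w \<in> ball 0 r \<Longrightarrow> cmod (g w - l * w) \<le> M * cmod (\<mu> - l)"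
    define e where "e = cmod (\<mu> - l)"
    have e: "e > 0" "e < \<epsilon>0" using ne small by (auto simp: e_def)
    define H where "H = (\<lambda>w. (g w - \<mu> * w) / (\<mu> - l))"
    have holH: "H holomorphic_on ball 0 r"
      unfolding H_def using ne by (intro holomorphic_intros hol) auto
    have gH: "g w = \<mu> * w + (\<mu> - l) * H w" for w
      using ne by (simp add: H_def)
    have H0: "H 0 = 0" by (simp add: H_def g0)
    have HB: "cmod (H w) \<le> M'" if w: "w \<in> ball 0 r" for w
    proof -
      have "H w = (g w - l * w) / (\<mu> - l) - w" using ne by (simp add: H_def field_simps)
      also have "cmod \<dots> \<le> cmod ((g w - l * w) / (\<mu> - l)) + cmod w" by (rule norm_triangle_ineq4)
      also have "cmod ((g w - l * w) / (\<mu> - l)) \<le> M"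
        using bd[OF w] e unfolding e_def by (simp add: norm_divide field_simps)
      finally show ?thesis using w by (simp add: M'_def)
    qed
    have dH: "deriv H 0 = 0"
    proof -
      have "(g has_field_derivative \<mu>) (at 0)"
        using holomorphic_derivI[OF hol, of 0] dg r by auto
      hence "(H has_field_derivative (\<mu> - \<mu> * 1) / (\<mu> - l)) (at 0)"
        unfolding H_def by (intro DERIV_cdivide DERIV_diff DERIV_cmult DERIV_ident)
      thus ?thesis by (simp add: DERIV_imp_deriv)
    qed
    define a where "a = (\<lambda>k. (deriv ^^ k) H 0 / fact k)"
    have a01: "a 0 = 0" "a 1 = 0" using H0 dH by (simp_all add: a_def)
    have ab: "cmod (a k) \<le> M' / r ^ k" for k
      using Taylor_coeff_bound[OF holH r HB, of k] r by (simp add: a_def field_simps)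
    define b where "b = (\<lambda>k. a k / (l - l ^ k))"
    have bC: "cmod (b k) \<le> C k" for k
      unfolding b_def C_def norm_divide using ab by (intro divide_right_mono) auto
    have div: "l - l ^ k \<noteq> 0" if k2: "k \<ge> 2" for k
    proof -
      obtain j where "k = Suc j" "j \<ge> 1" using k2 by (cases k) auto
      thus ?thesis using irr[of j] l by auto
    qed
    define q where "q = (\<lambda>w. \<Sum>k=2..<N. b k * w ^ k)"
    have q0: "q 0 = 0" by (simp add: q_def power_0_left)
    have holq: "q holomorphic_on A" for A unfolding q_def by (intro holomorphic_intros)
    have qQ: "cmod (q w) \<le> Q * cmod w ^ 2" if w: "w \<in> cball 0 t" for w
      unfolding q_def Q_def sum_distrib_right
    proof (rule sum_norm_le)
      fix k assume k: "k \<in> {2..<N}"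
      hence "k - 2 + 2 = k" by (intro le_add_diff_inverse2) simp
      hence "cmod w ^ k = cmod w ^ (k - 2) * cmod w ^ 2" by (metis power_add)
      also have "\<dots> \<le> t ^ (k - 2) * cmod w ^ 2"
        using w by (intro mult_right_mono power_mono) auto
      finally have "cmod w ^ k \<le> t ^ (k - 2) * cmod w ^ 2" .
      hence "cmod (b k) * cmod w ^ k \<le> C k * (t ^ (k - 2) * cmod w ^ 2)"
        using bC C by (intro mult_mono) auto
      thus "cmod (b k * w ^ k) \<le> C k * t ^ (k - 2) * (cmod w)\<^sup>2"
        by (simp add: norm_mult norm_power mult.assoc)
    qed
    have qLip: "cmod (q u - q v) \<le> Lip * cmod (u - v)" if "cmod u \<le> r" "cmod v \<le> r" for u v
      unfolding q_def Lip_def sum_distrib_right sum_subtractf[symmetric]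
    proof (rule sum_norm_le)
      fix k
      have "cmod (b k) * cmod (u ^ k - v ^ k) \<le> C k * (real k * r ^ (k - 1) * cmod (u - v))"
        using bC C norm_power_diff_le[OF that, of k] by (intro mult_mono) auto
      thus "cmod (b k * u ^ k - b k * v ^ k) \<le> C k * (real k * r ^ (k - 1)) * cmod (u - v)"
        by (simp add: norm_mult mult.assoc flip: right_diff_distrib)
    qed
    \<comment> \<open>The homological equation. The terms of degree \<open>0\<close> and \<open>1\<close>, where the divisor is bad, vanish in \<open>H\<close>.\<close>
    have hom: "q (l * w) - l * q w = - (\<Sum>k<N. a k * w ^ k)" for w
    proof -
      have "(\<Sum>k<N. a k * w ^ k) = (\<Sum>k=2..<N. a k * w ^ k)"
      proof (rule sum.mono_neutral_right)
        show "\<forall>i\<in>{..<N} - {2..<N}. a i * w ^ i = 0"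
        proof
          fix i assume "i \<in> {..<N} - {2..<N}"
          hence "i = 0 \<or> i = 1" by auto
          thus "a i * w ^ i = 0" using a01 by auto
        qed
      qed auto
      moreover have "q (l * w) - l * q w = (\<Sum>k=2..<N. - (a k * w ^ k))"
        unfolding q_def sum_distrib_left sum_subtractf[symmetric]
      proof (intro sum.cong refl)
        fix k assume "k \<in> {2..<N}"
        hence ab: "a k = b k * (l - l ^ k)" using div[of k] by (simp add: b_def)
        show "b k * (l * w) ^ k - l * (b k * w ^ k) = - (a k * w ^ k)"
          unfolding ab by (simp add: power_mult_distrib algebra_simps)
      qed
      ultimately show ?thesis by (simp add: sum_negf)
    qed
    define \<psi> where "\<psi> = (\<lambda>w. w + (\<mu> - l) * q w)"
    define E where "E = (\<lambda>w. H w + q (g w) - \<mu> * q w)"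
    have \<psi>E: "\<psi> (g w) - \<mu> * \<psi> w = (\<mu> - l) * E w" for w
      unfolding \<psi>_def E_def by (subst gH) (simp add: algebra_simps)
    have EB: "cmod (E w) \<le> \<delta>'" if w: "w \<in> ball 0 t" for w
    proof -
      have wr: "w \<in> ball 0 r" and wt: "cmod w < t" using w st by auto
      have gl: "cmod (g w - l * w) \<le> M * e" using bd[OF wr] by (simp add: e_def)
      have "e * (M + 1) \<le> r - t" using e M unfolding \<epsilon>0_def by (simp add: pos_less_divide_eq less_imp_le)
      hence Me: "M * e < r - t" using e M by (simp add: algebra_simps)
      have lw: "cmod (l * w) = cmod w" using l by (simp add: norm_mult)
      have "cmod (g w) \<le> cmod (g w - l * w) + cmod (l * w)"
        using norm_triangle_sub[of "g w" "l * w"] by simp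
      hence gr: "cmod (g w) \<le> r" using gl Me wt lw by linarith
      have "E w = (H w - (\<Sum>k<N. a k * w ^ k)) + (q (g w) - q (l * w)) - (\<mu> - l) * q w"
        unfolding E_def using hom[of w] by (simp add: algebra_simps)
      also have "cmod \<dots> \<le> cmod (H w - (\<Sum>k<N. a k * w ^ k)) + cmod (q (g w) - q (l * w)) + cmod ((\<mu> - l) * q w)"
        by (intro order_trans[OF norm_triangle_ineq4] add_mono norm_triangle_ineq order_refl)
      also have "cmod (H w - (\<Sum>k<N. a k * w ^ k)) \<le> M' * (t / r) ^ N / (1 - t / r)"
      proof -
        have "cmod (H w - (\<Sum>k<N. a k * w ^ k)) \<le> M' * (cmod w / r) ^ N / (1 - t / r)"
          unfolding a_def by (rule Taylor_tail_bound[OF holH r HB]) (use wt st in auto)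
        also have "\<dots> \<le> M' * (t / r) ^ N / (1 - t / r)"
          using wt st r M' by (intro divide_right_mono mult_left_mono power_mono) auto
        finally show ?thesis .
      qed
      also have "\<dots> \<le> \<delta>' / 2" using N by simp
      also have "cmod (q (g w) - q (l * w)) \<le> Lip * (M * e)"
        using qLip[OF gr] lw wr gl Lip by (intro order_trans[OF qLip[OF gr] mult_left_mono]) auto
      also have "cmod ((\<mu> - l) * q w) \<le> e * (Q * t ^ 2)"
        unfolding norm_mult e_def
        using wt Q by (intro mult_left_mono order_trans[OF qQ mult_left_mono] power_mono) auto
      also have "\<delta>' / 2 + Lip * (M * e) + e * (Q * t ^ 2) = \<delta>' / 2 + e * (D - 1)"
        by (simp add: D_def algebra_simps)
      also have "e * (D - 1) \<le> e * D" using e by simp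
      also have "e * D \<le> \<delta>' / 2"
        using e D unfolding \<epsilon>0_def by (simp add: field_simps)
      finally show ?thesis by simp
    qed
    have holE: "E holomorphic_on ball 0 t"
    proof -
      have "(q \<circ> g) holomorphic_on ball 0 t"
        by (rule holomorphic_on_compose) (use hol st holq in \<open>auto intro: holomorphic_on_subset\<close>)
      thus ?thesis unfolding E_def o_def
        using st by (intro holomorphic_intros holq holomorphic_on_subset[OF holH]) auto
    qed
    have E0: "E 0 = 0" by (simp add: E_def H0 g0 q0)
    have dE: "deriv E 0 = 0"
    proof -
      have dq: "(q has_field_derivative 0) (at 0)"
      proof -
        have "(q has_field_derivative (\<Sum>k=2..<N. b k * (of_nat k * 0 ^ (k - Suc 0)))) (at 0)"
          unfolding q_def by (auto intro!: derivative_eq_intros sum.cong)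
        also have "(\<Sum>k=2..<N. b k * (of_nat k * 0 ^ (k - Suc 0))) = 0"
          by (intro sum.neutral) (auto simp: power_0_left)
        finally show ?thesis .
      qed
      have dg': "(g has_field_derivative \<mu>) (at 0)"
        using holomorphic_derivI[OF hol, of 0] dg r by auto
      have dqg: "(q \<circ> g has_field_derivative 0 * \<mu>) (at 0)"
        by (rule DERIV_chain) (use dq dg' g0 in auto)
      have dH': "(H has_field_derivative 0) (at 0)"
        using holomorphic_derivI[OF holH, of 0] dH r by auto
      have "(E has_field_derivative 0 + 0 * \<mu> - \<mu> * 0) (at 0)"
        unfolding E_def using dqg unfolding o_def by (intro DERIV_add DERIV_diff dH' DERIV_cmult dq)
      thus ?thesis by (simp add: DERIV_imp_deriv)
    qed
    have EQ: "cmod (E w) \<le> \<delta> * cmod w ^ 2" if w: "w \<in> cball 0 s" for w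
    proof -
      have "cmod (E w - (\<Sum>k<2. (deriv ^^ k) E 0 / fact k * w ^ k)) \<le> \<delta>' * (cmod w / t) ^ 2 / (1 - s / t)"
        by (rule Taylor_tail_bound[OF holE _ EB]) (use w st in auto)
      moreover have "(\<Sum>k<2. (deriv ^^ k) E 0 / fact k * w ^ k) = 0"
        using E0 dE by (simp add: numeral_2_eq_2)
      moreover have "\<delta>' * (cmod w / t) ^ 2 / (1 - s / t) = \<delta> * cmod w ^ 2"
      proof -
        have "1 - s / t \<noteq> 0" "t \<noteq> 0" using st by (auto simp: field_simps)
        thus ?thesis by (simp add: \<delta>'_def power_divide)
      qed
      ultimately show ?thesis by simp
    qed
    show "\<exists>\<psi>. (\<forall>w\<in>cball 0 t. cmod (\<psi> w - w) \<le> cmod (\<mu> - l) * Q * cmod w ^ 2) \<and>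
           (\<forall>w\<in>cball 0 s. cmod (\<psi> (g w) - \<mu> * \<psi> w) \<le> cmod (\<mu> - l) * \<delta> * cmod w ^ 2)"
    proof (intro exI[of _ \<psi>] conjI ballI)
      fix w :: complex assume "w \<in> cball 0 t"
      thus "cmod (\<psi> w - w) \<le> cmod (\<mu> - l) * Q * cmod w ^ 2"
        using qQ[of w] by (simp add: \<psi>_def norm_mult mult.assoc mult_left_mono)
    next
      fix w :: complex assume "w \<in> cball 0 s"
      thus "cmod (\<psi> (g w) - \<mu> * \<psi> w) \<le> cmod (\<mu> - l) * \<delta> * cmod w ^ 2"
        using EQ[of w] by (simp add: \<psi>E norm_mult mult.assoc mult_left_mono)
    qed
  qed
qed

text \<open>
  Let \<open>e = \<bar>\<mu> - l\<bar>\<close>. Along an orbit \<open>\<bar>\<psi>\<bar>\<close> shrinks by the factor \<open>\<theta> = 1 - c e / 2\<close> in each step, because the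
  defect of \<open>\<psi>\<close> consumes at most half of the contraction \<open>c e\<close> of the multiplier. In
  \<open>\<psi>(g\<^sup>j(w)) = \<mu>\<^sup>j \<psi>(w) (1 + E\<^sub>0) ... (1 + E\<^sub>j\<^sub>-\<^sub>1)\<close> the relative errors are \<open>O(\<delta>A e \<theta>\<^sup>j)\<close>; their sum is
  \<open>O(\<delta>A / c)\<close>, with \<open>e\<close> cancelling, so that the product stays near \<open>1\<close> uniformly in \<open>g\<close>. A normalized
  solution \<open>k\<close> of the Schroeder equation agrees with \<open>\<psi>\<close> to first order at \<open>0\<close>, where the orbits tend, and is
  therefore compared with \<open>\<psi>\<close> at \<open>w\<close> by pulling back along the orbit.
\<close>

lemma perturbed_rotation:
  fixes l :: complex and \<rho> s r M c \<delta> :: real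
  assumes l: "cmod l = 1" and irr: "\<And>k. k \<ge> 1 \<Longrightarrow> l ^ k \<noteq> 1"
      and \<rho>s: "0 < \<rho>" "\<rho> < s" "s < r" and M: "M > 0" and c: "c > 0" and \<delta>: "\<delta> > 0"
  obtains \<epsilon>0 where "\<epsilon>0 > 0"
    "\<And>g \<mu>. g holomorphic_on ball 0 r \<Longrightarrow> g 0 = 0 \<Longrightarrow> deriv g 0 = \<mu> \<Longrightarrow> \<mu> \<noteq> l \<Longrightarrow>
       cmod (\<mu> - l) < \<epsilon>0 \<Longrightarrow> cmod \<mu> \<le> 1 - c * cmod (\<mu> - l) \<Longrightarrow>
       (\<And>w. w \<in> ball 0 r \<Longrightarrow> cmod (g w - l * w) \<le> M * cmod (\<mu> - l)) \<Longrightarrow>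
       (\<forall>w\<in>cball 0 \<rho>. \<forall>j. (g ^^ j) w \<in> cball 0 s) \<and>
       (\<forall>k. (k has_field_derivative 1) (at 0) \<longrightarrow> (\<forall>w\<in>cball 0 s. k (g w) = \<mu> * k w) \<longrightarrow>
          (\<forall>w\<in>cball 0 \<rho>. cmod (k w - w) \<le> \<delta>))"
proof -
  define t where "t = (s + r) / 2"
  have st: "0 < s" "s < t" "t < r" "0 < t" using \<rho>s by (auto simp: t_def)
  \<comment> \<open>The bound \<open>x\<close> for the sum of the relative errors is chosen so that \<open>(exp x - 1) * 2 s = \<delta> / 2\<close>.\<close>
  define x where "x = ln (1 + \<delta> / (4 * s))"
  have x: "x > 0" "exp x = 1 + \<delta> / (4 * s)"
    using \<delta> st by (simp_all add: x_def add_pos_pos)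
  define \<delta>A where "\<delta>A = min (c / (16 * s)) (c * x / (32 * s))"
  have \<delta>A: "\<delta>A > 0" "8 * \<delta>A * s \<le> c / 2" "32 * \<delta>A * s / c \<le> x"
    using c st x by (auto simp: \<delta>A_def min_def field_simps)
  obtain \<epsilon>1 Q where \<epsilon>1: "\<epsilon>1 > 0" and Q: "Q \<ge> 0" and lin:
    "\<And>g \<mu>. g holomorphic_on ball 0 r \<Longrightarrow> g 0 = 0 \<Longrightarrow> deriv g 0 = \<mu> \<Longrightarrow> \<mu> \<noteq> l \<Longrightarrow>
       cmod (\<mu> - l) < \<epsilon>1 \<Longrightarrow>
       (\<And>w. w \<in> ball 0 r \<Longrightarrow> cmod (g w - l * w) \<le> M * cmod (\<mu> - l)) \<Longrightarrow>
       \<exists>\<psi>. (\<forall>w\<in>cball 0 t. cmod (\<psi> w - w) \<le> cmod (\<mu> - l) * Q * cmod w ^ 2) \<and>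
           (\<forall>w\<in>cball 0 s. cmod (\<psi> (g w) - \<mu> * \<psi> w) \<le> cmod (\<mu> - l) * \<delta>A * cmod w ^ 2)"
    using approximate_linearization[OF l irr st(1,2,3) M \<delta>A(1)] by metis
  \<comment> \<open>In order: \<open>\<bar>\<mu>\<bar> \<ge> 1/2\<close>; \<open>\<psi>\<close> is comparable to the identity; orbits stay in the ball of radius \<open>s\<close>; one step leads from there into the domain of \<open>\<psi>\<close>; \<open>\<psi>\<close> is \<open>\<delta> / 2\<close>-close to the identity; \<open>\<theta> > 0\<close>.\<close>
  define m where "m = Min {1/2, (1/2) / (Q * t + 1), ((s - \<rho>) / 2) / (Q * t\<^sup>2 + 1), (t - s) / (M + 1), (\<delta> / 2) / (Q * s\<^sup>2 + 1), 1 / c}"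
  have m: "m > 0"
    unfolding m_def using st Q M \<delta> c \<rho>s
    by (subst Min_gr_iff) (auto intro!: divide_pos_pos add_nonneg_pos)
  have le: "e * b \<le> a" if "e < m" "m \<le> a / (b + 1)" "b \<ge> 0" "e > 0" for a b e :: real
  proof -
    have "e \<le> a / (b + 1)" using that by linarith
    hence "e * (b + 1) \<le> a" using that by (simp add: pos_le_divide_eq)
    moreover have "e * b \<le> e * (b + 1)" using that by (simp add: mult_left_mono)
    ultimately show ?thesis by linarith
  qed
  have mle: "m \<le> 1/2" "m \<le> (1/2) / (Q * t + 1)" "m \<le> ((s - \<rho>) / 2) / (Q * t\<^sup>2 + 1)"
     "m \<le> (t - s) / (M + 1)" "m \<le> (\<delta> / 2) / (Q * s\<^sup>2 + 1)" "m \<le> 1 / c"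
    unfolding m_def by (rule Min_le; simp)+
  show ?thesis
  proof (rule that[of "min \<epsilon>1 m"])
    show "min \<epsilon>1 m > 0" using \<epsilon>1 m by simp
  next
    fix g \<mu>
    assume hol: "g holomorphic_on ball 0 r" and g0: "g 0 = 0" and dg: "deriv g 0 = \<mu>"
      and ne: "\<mu> \<noteq> l" and small: "cmod (\<mu> - l) < min \<epsilon>1 m"
      and stolz: "cmod \<mu> \<le> 1 - c * cmod (\<mu> - l)"
      and bd: "\<And>w. w \<in> ball 0 r \<Longrightarrow> cmod (g w - l * w) \<le> M * cmod (\<mu> - l)"
    define e where "e = cmod (\<mu> - l)"
    have e: "e > 0" "e < m" "e < \<epsilon>1" using ne small by (auto simp: e_def)
    have sm: "e < 1/2" "e * (Q * t) \<le> 1/2" "e * (Q * t\<^sup>2) \<le> (s - \<rho>) / 2"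
       "e * M \<le> t - s" "e * (Q * s\<^sup>2) \<le> \<delta> / 2" "c * e < 1"
      using le[OF e(2) mle(2)] le[OF e(2) mle(3)] le[OF e(2) mle(4)] le[OF e(2) mle(5)]
            mle(1,6) e Q st M c
      by (auto simp: pos_less_divide_eq mult.commute
               dest!: less_le_trans[OF e(2)])
    note sm = sm(1,2) sm(3)[folded mult.assoc] sm(4) sm(5)[folded mult.assoc] sm(6)
    have \<mu>: "cmod \<mu> \<ge> 1/2" "cmod \<mu> < 1"
    proof -
      have "cmod l \<le> cmod \<mu> + e" unfolding e_def by (metis norm_minus_commute norm_triangle_sub)
      thus "cmod \<mu> \<ge> 1/2" using l sm(1) by linarith
      show "cmod \<mu> < 1" using stolz c e by (smt (verit) e_def mult_pos_pos)
    qed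
    have "\<exists>\<psi>. (\<forall>w\<in>cball 0 t. cmod (\<psi> w - w) \<le> e * Q * cmod w ^ 2) \<and>
           (\<forall>w\<in>cball 0 s. cmod (\<psi> (g w) - \<mu> * \<psi> w) \<le> e * \<delta>A * cmod w ^ 2)"
      unfolding e_def by (rule lin[OF hol g0 dg ne _ bd]) (use e in \<open>auto simp: e_def\<close>)
    then obtain \<psi> where \<psi>:
      "\<forall>w\<in>cball 0 t. cmod (\<psi> w - w) \<le> e * Q * cmod w ^ 2"
      "\<forall>w\<in>cball 0 s. cmod (\<psi> (g w) - \<mu> * \<psi> w) \<le> e * \<delta>A * cmod w ^ 2"
      by blast
    hence
      \<psi>1: "\<And>w. cmod w \<le> t \<Longrightarrow> cmod (\<psi> w - w) \<le> e * Q * cmod w ^ 2" and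
      \<psi>2: "\<And>w. cmod w \<le> s \<Longrightarrow> cmod (\<psi> (g w) - \<mu> * \<psi> w) \<le> e * \<delta>A * cmod w ^ 2"
      by simp_all
    have half: "cmod (\<psi> w - w) \<le> cmod w / 2" if w: "cmod w \<le> t" for w
    proof -
      have "cmod (\<psi> w - w) \<le> (e * Q * cmod w) * cmod w"
        using \<psi>1[OF w] by (simp add: power2_eq_square mult.assoc)
      also have "e * Q * cmod w \<le> e * Q * t"
        using w e Q by (intro mult_left_mono) auto
      also have "e * Q * t \<le> 1/2" using sm by (simp add: mult.assoc)
      finally show ?thesis by (simp add: mult_right_mono)
    qed
    have lower: "cmod w \<le> 2 * cmod (\<psi> w)" and upper: "cmod (\<psi> w) \<le> 2 * cmod w" if "cmod w \<le> t" for w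
      using half[OF that] norm_triangle_ineq2[of w "\<psi> w"] norm_triangle_ineq2[of "\<psi> w" w]
      by (auto simp: norm_minus_commute)
    have step: "cmod (\<psi> (g w) - \<mu> * \<psi> w) \<le> 4 * e * \<delta>A * cmod (\<psi> w) ^ 2" if w: "cmod w \<le> s" for w
    proof -
      have "cmod w ^ 2 \<le> (2 * cmod (\<psi> w)) ^ 2"
        using lower[of w] w st by (intro power_mono) auto
      hence "e * \<delta>A * cmod w ^ 2 \<le> e * \<delta>A * (2 * cmod (\<psi> w)) ^ 2"
        using e \<delta>A by (intro mult_left_mono) auto
      thus ?thesis using \<psi>2[OF w] by (simp add: power_mult_distrib mult_ac)
    qed
    define \<theta> where "\<theta> = 1 - c * e / 2"
    have \<theta>: "0 < \<theta>" "\<theta> < 1" using sm e c by (auto simp: \<theta>_def)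
    have contr: "cmod (\<psi> (g w)) \<le> \<theta> * cmod (\<psi> w)" if w: "cmod w \<le> s" for w
    proof -
      have "cmod (\<psi> w) \<le> 2 * s" using upper[of w] w st by linarith
      hence "cmod (\<psi> w) ^ 2 \<le> 2 * s * cmod (\<psi> w)"
        unfolding power2_eq_square by (rule mult_right_mono) simp
      hence "4 * e * \<delta>A * cmod (\<psi> w) ^ 2 \<le> 4 * e * \<delta>A * (2 * s * cmod (\<psi> w))"
        using e \<delta>A by (intro mult_left_mono) auto
      also have "\<dots> = (4 * e * \<delta>A * (2 * s)) * cmod (\<psi> w)" by simp
      also have "4 * e * \<delta>A * (2 * s) = e * (8 * \<delta>A * s)" by simp
      also have "e * (8 * \<delta>A * s) \<le> e * (c / 2)" using \<delta>A(2) e by (intro mult_left_mono) auto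
      finally have 1: "4 * e * \<delta>A * cmod (\<psi> w) ^ 2 \<le> e * (c / 2) * cmod (\<psi> w)"
        by (simp add: mult_right_mono)
      have "cmod (\<psi> (g w)) \<le> cmod (\<mu> * \<psi> w) + cmod (\<psi> (g w) - \<mu> * \<psi> w)"
        using norm_triangle_sub by blast
      also have "\<dots> \<le> (1 - c * e) * cmod (\<psi> w) + e * (c / 2) * cmod (\<psi> w)"
        using step[OF w] 1 stolz by (intro add_mono) (auto simp: norm_mult e_def mult_right_mono)
      also have "\<dots> = \<theta> * cmod (\<psi> w)" by (simp add: \<theta>_def algebra_simps)
      finally show ?thesis .
    qed
    have orbit: "cmod ((g ^^ j) w) \<le> s \<and> cmod (\<psi> ((g ^^ j) w)) \<le> \<theta> ^ j * cmod (\<psi> w)"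
      if w: "cmod w \<le> \<rho>" for w j
    proof (induction j)
      case 0
      thus ?case using w \<rho>s by simp
    next
      case (Suc j)
      define u where "u = (g ^^ j) w"
      have u: "cmod u \<le> s" "cmod (\<psi> u) \<le> \<theta> ^ j * cmod (\<psi> w)" using Suc by (auto simp: u_def)
      have 1: "cmod (\<psi> (g u)) \<le> \<theta> ^ Suc j * cmod (\<psi> w)"
        using order_trans[OF contr[OF u(1)] mult_left_mono[OF u(2), of \<theta>]] \<theta>
        by (simp add: mult.assoc)
      also have "\<dots> \<le> cmod (\<psi> w)"
        using \<theta> by (intro mult_left_le_one_le power_le_one) auto
      also have "\<dots> \<le> \<rho> + (s - \<rho>) / 2"
      proof -
        have "e * Q * cmod w ^ 2 \<le> e * Q * t\<^sup>2"
          using w \<rho>s st e Q by (intro mult_left_mono power_mono) auto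
        moreover have "cmod w \<le> t" using w \<rho>s st by linarith
        ultimately show ?thesis
          using \<psi>1[of w] w sm(3) norm_triangle_sub[of "\<psi> w" w] by linarith
      qed
      finally have 2: "cmod (\<psi> (g u)) \<le> \<rho> + (s - \<rho>) / 2" .
      have gu: "cmod (g u) \<le> t"
      proof -
        have "cmod (g u - l * u) \<le> e * M" using bd[of u] u st by (simp add: e_def mult.commute)
        moreover have "cmod (g u) \<le> cmod (l * u) + cmod (g u - l * u)" by (rule norm_triangle_sub)
        ultimately show ?thesis using u l sm(4) by (simp add: norm_mult)
      qed
      have "cmod (\<psi> (g u) - g u) \<le> (s - \<rho>) / 2"
      proof -
        have "e * Q * cmod (g u) ^ 2 \<le> e * Q * t\<^sup>2"
          using gu e Q by (intro mult_left_mono power_mono) auto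
        thus ?thesis using \<psi>1[OF gu] sm(3) by linarith
      qed
      hence "cmod (g u) \<le> s" using 2 norm_triangle_ineq2[of "g u" "\<psi> (g u)"]
          norm_minus_commute[of "g u" "\<psi> (g u)"] by argo
      with 1 show ?case by (simp add: u_def)
    qed
    have "cmod (k w - w) \<le> \<delta>"
      if k1: "(k has_field_derivative 1) (at 0)" and kg: "\<And>w. cmod w \<le> s \<Longrightarrow> k (g w) = \<mu> * k w"
        and w: "cmod w \<le> \<rho>" for k w
    proof -
      have k0: "k 0 = 0"
        using kg[of 0] g0 st \<mu> by (auto simp: mult_cancel_right1)
      define W where "W = (\<lambda>j. (g ^^ j) w)"
      have Ws: "cmod (W j) \<le> s" and W\<psi>: "cmod (\<psi> (W j)) \<le> \<theta> ^ j * cmod (\<psi> w)" for j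
        using orbit[OF w] by (auto simp: W_def)
      have \<psi>w: "cmod (\<psi> w) \<le> 2 * s" using upper[of w] w \<rho>s st by simp
      have kW: "k (W j) = \<mu> ^ j * k w" for j
        by (induction j) (use kg[OF Ws] in \<open>auto simp: W_def\<close>)
      \<comment> \<open>If \<open>\<psi> (W j) = 0\<close>, this is \<open>0 / 0 = 0\<close>, as it should be: then \<open>\<psi>\<close> vanishes along the rest of the orbit.\<close>
      define E where "E = (\<lambda>j. (\<psi> (W (Suc j)) - \<mu> * \<psi> (W j)) / (\<mu> * \<psi> (W j)))"
      have \<mu>0: "\<mu> \<noteq> 0" using \<mu> by auto
      have rec: "\<psi> (W (Suc j)) = \<mu> * \<psi> (W j) * (1 + E j)" for j
      proof (cases "\<psi> (W j) = 0")
        case True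
        have "\<psi> (W (Suc j)) = 0" using contr[OF Ws[of j]] True by (simp add: W_def)
        thus ?thesis using True by simp
      next
        case False
        thus ?thesis using \<mu>0 by (simp add: E_def field_simps)
      qed
      have prod: "\<psi> (W j) = \<mu> ^ j * \<psi> w * (\<Prod>i<j. 1 + E i)" for j
        by (induction j) (use rec in \<open>auto simp: W_def mult_ac\<close>)
      have EB: "cmod (E j) \<le> 16 * e * \<delta>A * s * \<theta> ^ j" for j
      proof (cases "\<psi> (W j) = 0")
        case True
        thus ?thesis using e \<delta>A st \<theta> by (simp add: E_def)
      next
        case False
        have "cmod (E j) \<le> 4 * e * \<delta>A * cmod (\<psi> (W j)) ^ 2 / (cmod \<mu> * cmod (\<psi> (W j)))"
          unfolding E_def norm_divide norm_mult[of \<mu>]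
          using step[OF Ws[of j]] by (intro divide_right_mono) (auto simp: W_def)
        also have "\<dots> = 4 * e * \<delta>A * (cmod (\<psi> (W j)) / cmod \<mu>)"
          using False by (simp add: power2_eq_square)
        also have "cmod (\<psi> (W j)) / cmod \<mu> \<le> (\<theta> ^ j * (2 * s)) / (1 / 2)"
          using W\<psi>[of j] \<psi>w \<mu> \<theta> st
          by (intro frac_le order_trans[OF W\<psi> mult_left_mono]) auto
        also have "4 * e * \<delta>A * ((\<theta> ^ j * (2 * s)) / (1 / 2)) = 16 * e * \<delta>A * s * \<theta> ^ j"
          by simp
        finally show ?thesis using e \<delta>A by (simp add: mult_left_mono)
      qed
      have sumE: "(\<Sum>i<j. cmod (E i)) \<le> x" for j
      proof -
        have "(\<Sum>i<j. cmod (E i)) \<le> (\<Sum>i<j. 16 * e * \<delta>A * s * \<theta> ^ i)"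
          by (intro sum_mono EB)
        also have "\<dots> = 16 * e * \<delta>A * s * ((1 - \<theta> ^ j) / (1 - \<theta>))"
          using \<theta> by (simp add: sum_gp_strict flip: sum_distrib_left)
        also have "(1 - \<theta> ^ j) / (1 - \<theta>) \<le> 1 / (c * e / 2)"
          using \<theta> c e by (intro frac_le) (auto simp: \<theta>_def)
        also have "16 * e * \<delta>A * s * (1 / (c * e / 2)) = 32 * \<delta>A * s / c"
          using e c by (simp add: field_simps)
        also have "\<dots> \<le> x" by (rule \<delta>A)
        finally show ?thesis using e \<delta>A st by (simp add: mult_left_mono)
      qed
      have prodE: "cmod ((\<Prod>i<j. 1 + E i) - 1) \<le> exp x - 1" for j
      proof -
        have "cmod ((\<Prod>i<j. 1 + E i) - 1) \<le> (\<Prod>i<j. 1 + cmod (E i)) - 1"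
          by (rule norm_prod_minus1_le_prod_minus1)
        also have "(\<Prod>i<j. 1 + cmod (E i)) \<le> exp (\<Sum>i<j. cmod (E i))"
          by (rule prod_le_exp_sum) auto
        also have "exp (\<Sum>i<j. cmod (E i)) \<le> exp x" using sumE by simp
        finally show ?thesis by simp
      qed
      \<comment> \<open>The comparison of \<open>k\<close> with \<open>\<psi>\<close> takes place far along the orbit, where both are tangent to the identity.\<close>
      have W0: "W \<longlonglongrightarrow> 0"
      proof (rule tendsto_norm_zero_cancel, rule tendsto_sandwich)
        show "eventually (\<lambda>j. 0 \<le> cmod (W j)) sequentially" by simp
        have "cmod (W j) \<le> \<theta> ^ j * (2 * cmod (\<psi> w))" for j
          using lower[of "W j"] Ws[of j] W\<psi>[of j] st by simp
        thus "eventually (\<lambda>j. cmod (W j) \<le> \<theta> ^ j * (2 * cmod (\<psi> w))) sequentially" by simp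
        have "(\<lambda>j. \<theta> ^ j * (2 * cmod (\<psi> w))) \<longlonglongrightarrow> 0 * (2 * cmod (\<psi> w))"
          using \<theta> by (intro tendsto_intros LIMSEQ_power_zero) auto
        thus "(\<lambda>j. \<theta> ^ j * (2 * cmod (\<psi> w))) \<longlonglongrightarrow> 0" by simp
      qed auto
      have close: "cmod (k w - \<psi> w) \<le> (exp x - 1) * cmod (\<psi> w) + \<eta> * (exp x * cmod (\<psi> w))"
        if \<eta>: "\<eta> > 0" for \<eta>
      proof -
        have "((\<lambda>u. (k u - k 0) / (u - 0)) \<longlongrightarrow> 1) (at 0)"
          using k1 unfolding has_field_derivative_iff by simp
        hence "eventually (\<lambda>u. dist (k u / u) 1 < \<eta> / 4) (at 0)"
          using \<eta> k0 by (intro tendstoD) auto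
        hence ev1: "eventually (\<lambda>u. cmod (k u - u) \<le> \<eta> / 4 * cmod u) (nhds 0)"
          unfolding eventually_at_filter
        proof eventually_elim
          case (elim u)
          show ?case
          proof (cases "u = 0")
            case False
            have "k u - u = (k u / u - 1) * u" using False by (simp add: field_simps)
            hence "cmod (k u - u) = cmod (k u / u - 1) * cmod u" by (simp add: norm_mult)
            thus ?thesis using elim False
              by (auto simp: dist_norm intro!: mult_right_mono)
          qed (use k0 in auto)
        qed
        have "eventually (\<lambda>u. e * Q * cmod u < \<eta> / 4) (nhds 0)"
        proof (rule order_tendstoD)
          show "((\<lambda>u. e * Q * cmod u) \<longlongrightarrow> e * Q * cmod 0) (nhds 0)"
            by (intro tendsto_intros filterlim_ident)
        qed (use \<eta> in auto)
        with ev1 have ev2: "eventually (\<lambda>u. cmod (k u - u) \<le> \<eta> / 4 * cmod u \<and> e * Q * cmod u < \<eta> / 4) (nhds 0)"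
          by (rule eventually_conj)
        have "eventually (\<lambda>j. cmod (k (W j) - W j) \<le> \<eta> / 4 * cmod (W j) \<and> e * Q * cmod (W j) < \<eta> / 4) sequentially"
          using ev2 W0 unfolding filterlim_iff by auto
        from eventually_happens'[OF sequentially_bot this] obtain j
          where j: "cmod (k (W j) - W j) \<le> \<eta> / 4 * cmod (W j)" "e * Q * cmod (W j) < \<eta> / 4"
          by blast
        have "cmod (\<psi> (W j) - W j) \<le> e * Q * cmod (W j) * cmod (W j)"
          using \<psi>1[of "W j"] Ws[of j] st by (simp add: power2_eq_square mult.assoc)
        also have "\<dots> \<le> \<eta> / 4 * cmod (W j)" using j(2) by (intro mult_right_mono) auto
        finally have "cmod (k (W j) - \<psi> (W j)) \<le> \<eta> / 2 * cmod (W j)"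
          using j(1) norm_triangle_ineq4[of "k (W j) - W j" "\<psi> (W j) - W j"] by simp
        also have "\<dots> \<le> \<eta> / 2 * (2 * cmod (\<psi> (W j)))"
          using lower[of "W j"] Ws[of j] st \<eta> by (intro mult_left_mono) auto
        finally have kj: "cmod (k (W j) - \<psi> (W j)) \<le> \<eta> * cmod (\<psi> (W j))" by simp
        define P where "P = (\<Prod>i<j. 1 + E i)"
        have P: "cmod (P - 1) \<le> exp x - 1" "cmod P \<le> exp x"
          using prodE[of j] norm_triangle_sub[of P 1] by (auto simp: P_def)
        have "cmod \<mu> ^ j * cmod (k w - \<psi> w * P) \<le> cmod \<mu> ^ j * (\<eta> * cmod (\<psi> w * P))"
        proof -
          have "k (W j) - \<psi> (W j) = \<mu> ^ j * (k w - \<psi> w * P)"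
            unfolding kW prod P_def by (simp add: algebra_simps)
          moreover have "cmod (\<psi> (W j)) = cmod \<mu> ^ j * cmod (\<psi> w * P)"
            unfolding prod P_def by (simp add: norm_mult norm_power)
          ultimately show ?thesis using kj by (simp add: norm_mult norm_power mult_ac)
        qed
        hence 1: "cmod (k w - \<psi> w * P) \<le> \<eta> * cmod (\<psi> w * P)"
          using \<mu>0 by (simp add: mult_le_cancel_left_pos)
        have "k w - \<psi> w = (k w - \<psi> w * P) + \<psi> w * (P - 1)" by (simp add: algebra_simps)
        hence "cmod (k w - \<psi> w) \<le> cmod (k w - \<psi> w * P) + cmod (\<psi> w * (P - 1))"
          by (metis norm_triangle_ineq)
        also have "cmod (\<psi> w * (P - 1)) \<le> (exp x - 1) * cmod (\<psi> w)"
          using P(1) by (simp add: norm_mult mult.commute mult_left_mono)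
        also have "cmod (k w - \<psi> w * P) \<le> \<eta> * (exp x * cmod (\<psi> w))"
          using P(2) \<eta> unfolding norm_mult[of "\<psi> w"] mult.commute[of "cmod (\<psi> w)"]
          by (intro order_trans[OF 1[unfolded norm_mult[of "\<psi> w"] mult.commute[of "cmod (\<psi> w)"]]]
               mult_left_mono mult_right_mono) auto
        finally show ?thesis by simp
      qed
      have "cmod (k w - \<psi> w) \<le> (exp x - 1) * cmod (\<psi> w)"
      proof (rule tendsto_lowerbound)
        have "((\<lambda>\<eta>. (exp x - 1) * cmod (\<psi> w) + \<eta> * (exp x * cmod (\<psi> w))) \<longlongrightarrow> (exp x - 1) * cmod (\<psi> w) + 0 * (exp x * cmod (\<psi> w))) (at_right 0)"
          by (intro tendsto_intros)
        thus "((\<lambda>\<eta>. (exp x - 1) * cmod (\<psi> w) + \<eta> * (exp x * cmod (\<psi> w))) \<longlongrightarrow> (exp x - 1) * cmod (\<psi> w)) (at_right 0)"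
          by simp
        show "eventually (\<lambda>\<eta>. cmod (k w - \<psi> w) \<le> (exp x - 1) * cmod (\<psi> w) + \<eta> * (exp x * cmod (\<psi> w))) (at_right 0)"
          unfolding eventually_at_right_field by (intro exI[of _ 1]) (auto intro: close)
      qed auto
      also have "\<dots> \<le> (exp x - 1) * (2 * s)" using \<psi>w x \<delta> st by (intro mult_left_mono) auto
      also have "\<dots> = \<delta> / 2" using st by (simp add: x)
      finally have 1: "cmod (k w - \<psi> w) \<le> \<delta> / 2" .
      have "cmod (\<psi> w - w) \<le> e * Q * cmod w ^ 2" using \<psi>1[of w] w \<rho>s st by simp
      also have "\<dots> \<le> e * Q * s ^ 2" using w \<rho>s e Q by (intro mult_left_mono power_mono) auto
      also have "\<dots> \<le> \<delta> / 2" by (rule sm(5))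
      finally show ?thesis using 1 norm_triangle_ineq[of "k w - \<psi> w" "\<psi> w - w"] by simp
    qed
    thus "(\<forall>w\<in>cball 0 \<rho>. \<forall>j. (g ^^ j) w \<in> cball 0 s) \<and>
       (\<forall>k. (k has_field_derivative 1) (at 0) \<longrightarrow> (\<forall>w\<in>cball 0 s. k (g w) = \<mu> * k w) \<longrightarrow>
          (\<forall>w\<in>cball 0 \<rho>. cmod (k w - w) \<le> \<delta>))"
      using orbit by auto
  qed
qed

section \<open>Normal families in the spherical metric\<close>

lemma snd_to_sphere: "snd (to_sphere z) = 1 - 2 / ((cmod z)\<^sup>2 + 1)"
proof -
  have "(cmod z)\<^sup>2 + 1 \<noteq> 0" by (smt (verit) zero_le_power2)
  thus ?thesis by (simp add: to_sphere_def field_simps)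
qed

lemma cmod_if_snd_to_sphere_less:
  assumes "snd (to_sphere z) < 1 - e" "e > 0"
  shows "(cmod z)\<^sup>2 < 2 / e"
proof -
  have "e < 2 / ((cmod z)\<^sup>2 + 1)" using assms by (simp add: snd_to_sphere)
  moreover have "(cmod z)\<^sup>2 + 1 > 0" by (smt (verit) zero_le_power2)
  ultimately have "e * ((cmod z)\<^sup>2 + 1) < 2" by (simp add: pos_less_divide_eq)
  hence "(cmod z)\<^sup>2 + 1 < 2 / e" using assms by (simp add: pos_less_divide_eq mult.commute)
  thus ?thesis by simp
qed

lemma snd_to_sphere_le:
  assumes "cmod z \<le> B"
  shows "snd (to_sphere z) \<le> 1 - 2 / (B\<^sup>2 + 1)"
proof -
  have "(cmod z)\<^sup>2 \<le> B\<^sup>2" using assms by (intro power_mono) auto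
  hence "2 / (B\<^sup>2 + 1) \<le> 2 / ((cmod z)\<^sup>2 + 1)"
    by (intro divide_left_mono mult_pos_pos) (auto intro: add_nonneg_pos)
  thus ?thesis by (simp add: snd_to_sphere)
qed

text \<open>
  Near the north pole the coordinate \<open>1 / z\<close> is a continuous function of the point on the sphere. This
  turns spherical convergence near infinity into convergence of reciprocals.
\<close>

lemma inverse_via_sphere:
  assumes "z \<noteq> 0"
  shows "1 / z = cnj (fst (to_sphere z)) / of_real (1 + snd (to_sphere z))"
proof -
  define n where "n = (cmod z)\<^sup>2"
  have n: "n > 0" using assms by (simp add: n_def)
  have "1 + snd (to_sphere z) = 2 * n / (1 + n)"
    using n by (simp add: snd_to_sphere n_def[symmetric] field_simps)
  moreover have "cnj (fst (to_sphere z)) = 2 * cnj z / of_real (1 + n)"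
    by (simp add: to_sphere_def n_def)
  ultimately have "cnj (fst (to_sphere z)) / of_real (1 + snd (to_sphere z)) =
      (2 * cnj z / of_real (1 + n)) / of_real (2 * n / (1 + n))"
    by (simp only:)
  also have "\<dots> = cnj z / of_real n"
  proof -
    have "(2 * cnj z / a) / (2 * b / a) = cnj z / b" if "a \<noteq> 0" "b \<noteq> 0" for a b
      using that by simp
    moreover have "complex_of_real (1 + n) \<noteq> 0" "complex_of_real n \<noteq> 0"
      using n by (simp_all add: complex_eq_iff)
    ultimately show ?thesis unfolding of_real_divide of_real_mult of_real_numeral by blast
  qed
  also have "of_real n = z * cnj z" unfolding n_def by (rule complex_norm_square)
  finally show ?thesis using assms by simp
qed

lemma continuous_on_to_sphere: "continuous_on A to_sphere"
proof -
  have "1 + (cmod x)\<^sup>2 \<noteq> 0" "(cmod x)\<^sup>2 + 1 \<noteq> 0" for x by (smt (verit) zero_le_power2)+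
  moreover from this have "1 + (complex_of_real (cmod x))\<^sup>2 \<noteq> 0" for x
    by (metis of_real_1 of_real_add of_real_eq_0_iff of_real_power)
  ultimately show ?thesis
    unfolding to_sphere_def by (intro continuous_intros) auto
qed

lemma normal_family_on_subset:
  assumes "normal_family_on F V" "W \<subseteq> V"
  shows "normal_family_on F W"
  using assms unfolding normal_family_on_def by (meson image_mono order_trans subset_trans)

text \<open>
  Montel's theorem gives locally uniform limits in the plane, and \<open>to_sphere\<close> is uniformly continuous on discs.
\<close>

lemma bounded_imp_normal_family:
  assumes V: "open V" and hol: "\<And>h. h \<in> F \<Longrightarrow> h holomorphic_on V"
      and B: "\<And>h z. h \<in> F \<Longrightarrow> z \<in> V \<Longrightarrow> cmod (h z) \<le> B"
  shows "normal_family_on F V"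
  unfolding normal_family_on_def
proof (intro allI impI)
  fix h :: "nat \<Rightarrow> complex \<Rightarrow> complex" assume h: "range h \<subseteq> F"
  obtain g r where g: "g holomorphic_on V" "strict_mono (r :: nat \<Rightarrow> nat)"
      "\<And>x. x \<in> V \<Longrightarrow> (\<lambda>n. h (r n) x) \<longlonglongrightarrow> g x"
      "\<And>K. compact K \<Longrightarrow> K \<subseteq> V \<Longrightarrow> uniform_limit K (h \<circ> r) g sequentially"
  proof (rule Montel[OF V, of F h])
    show "\<exists>B. \<forall>h\<in>F. \<forall>z\<in>K. cmod (h z) \<le> B" if "compact K" "K \<subseteq> V" for K
      using B that by blast
  qed (use hol h in auto)
  have gB: "g z \<in> cball 0 B" if z: "z \<in> V" for z
  proof -
    have "cmod (g z) \<le> B"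
      by (rule LIMSEQ_le_const2[OF tendsto_norm[OF g(3)[OF z]]]) (use h B z in blast)
    thus ?thesis by simp
  qed
  have uc: "uniformly_continuous_on (cball 0 B) to_sphere"
    by (intro compact_uniformly_continuous continuous_on_to_sphere) auto
  show "\<exists>(r :: nat \<Rightarrow> nat) g. strict_mono r \<and> g ` V \<subseteq> riemann_sphere \<and>
           (\<forall>K. compact K \<and> K \<subseteq> V \<longrightarrow>
              uniform_limit K (\<lambda>n z. to_sphere (h (r n) z)) g sequentially)"
  proof (intro exI[of _ r] exI[of _ "\<lambda>z. to_sphere (g z)"] conjI allI impI)
    fix K assume K: "compact K \<and> K \<subseteq> V"
    show "uniform_limit K (\<lambda>n z. to_sphere (h (r n) z)) (\<lambda>z. to_sphere (g z)) sequentially"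
    proof (rule uniform_limit_compose_uniformly_continuous_on[OF _ uc])
      show "uniform_limit K (\<lambda>n. h (r n)) g sequentially"
        using g(4)[of K] K by (simp add: o_def)
      show "\<forall>\<^sub>F n in sequentially. \<forall>z\<in>K. h (r n) z \<in> cball 0 B"
        using h B K by (intro always_eventually) (auto simp: subset_iff)
    qed auto
  qed (use g(2) to_sphere_in_riemann_sphere in auto)
qed

lemma sphere_limit_continuous:
  assumes V: "open V" and h: "\<And>k::nat. h k holomorphic_on V"
      and lim: "\<And>K. compact K \<Longrightarrow> K \<subseteq> V \<Longrightarrow>
                  uniform_limit K (\<lambda>k z. to_sphere (h k z)) g sequentially"
  shows "continuous_on V g"
proof (rule continuous_at_imp_continuous_on, intro ballI)
  fix z assume "z \<in> V"
  then obtain r where r: "r > 0" "cball z r \<subseteq> V" using V open_contains_cball by blast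
  have "continuous_on (cball z r) g"
  proof (rule uniform_limit_theorem[OF _ lim])
    have "continuous_on (cball z r) (\<lambda>w. to_sphere (h k w))" for k
      using h[of k] r
      by (intro continuous_on_compose2[OF continuous_on_to_sphere[of UNIV]]
            holomorphic_on_imp_continuous_on holomorphic_on_subset[OF h]) auto
    thus "\<forall>\<^sub>F k in sequentially. continuous_on (cball z r) (\<lambda>w. to_sphere (h k w))" by simp
  qed (use r in auto)
  thus "isCont g z"
    by (rule continuous_on_interior) (use r in auto)
qed

text \<open>
  A locally uniform spherical limit of holomorphic functions on a connected set is infinite everywhere
  or nowhere. Near a point where the limit is infinite the reciprocals \<open>1 / h k\<close> are holomorphic, bounded
  and without zeros, while their limit vanishes at that point; by Hurwitz' theorem it vanishes near it. So
  the set where the limit is the north pole is open and closed.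
\<close>

lemma sphere_limit_finite:
  assumes V: "open V" "connected V" and h: "\<And>k::nat. h k holomorphic_on V"
      and g: "g ` V \<subseteq> riemann_sphere"
      and lim: "\<And>K. compact K \<Longrightarrow> K \<subseteq> V \<Longrightarrow>
                  uniform_limit K (\<lambda>k z. to_sphere (h k z)) g sequentially"
      and b: "b \<in> V" "snd (g b) < 1" and z: "z \<in> V"
  shows "snd (g z) < 1"
proof -
  have cont: "continuous_on V g" by (rule sphere_limit_continuous[OF V(1) h lim])
  have sphere: "(cmod (fst (g w)))\<^sup>2 + (snd (g w))\<^sup>2 = 1" if "w \<in> V" for w
  proof -
    have "norm (g w) = 1" using g that by (auto simp: riemann_sphere_def)
    thus ?thesis by (simp add: norm_prod_def)
  qed
  define N where "N = {z \<in> V. snd (g z) = 1}"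
  have closed: "closedin (top_of_set V) N"
    unfolding N_def by (intro continuous_closedin_preimage_constant continuous_intros cont)
  have "\<exists>r>0. ball w r \<subseteq> N" if w: "w \<in> N" for w
  proof -
    have wV: "w \<in> V" and gw: "snd (g w) = 1" using w by (auto simp: N_def)
    obtain r1 where r1: "r1 > 0" "cball w r1 \<subseteq> V" using V wV open_contains_cball by blast
    have "isCont g w" using cont V(1) wV continuous_on_eq_continuous_at by blast
    then obtain r2 where r2: "r2 > 0" "\<And>u. dist u w < r2 \<Longrightarrow> dist (g u) (g w) < 1/4"
      unfolding continuous_at_eps_delta using zero_less_divide_1_iff by (metis zero_less_numeral)
    define r where "r = min r1 (r2 / 2)"
    have r: "r > 0" "cball w r \<subseteq> V" using r1 r2 by (auto simp: r_def)
    have snd_close: "\<bar>snd p - snd q\<bar> \<le> dist p q" for p q :: "complex \<times> real"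
      using dist_snd_le[of p q] by (simp add: dist_real_def)
    have g34: "snd (g u) > 3/4" if "u \<in> cball w r" for u
    proof -
      have "dist (g u) (g w) < 1/4"
        using that r2 by (intro r2(2)) (auto simp: r_def dist_commute)
      thus ?thesis using snd_close[of "g u" "g w"] gw by linarith
    qed
    have "uniform_limit (cball w r) (\<lambda>k z. to_sphere (h k z)) g sequentially"
      using lim r by auto
    hence "\<forall>\<^sub>F k in sequentially. \<forall>u\<in>cball w r. dist (to_sphere (h k u)) (g u) < 1/4"
      by (rule uniform_limitD) simp
    then obtain k0 where k0: "\<And>k u. k \<ge> k0 \<Longrightarrow> u \<in> cball w r \<Longrightarrow> dist (to_sphere (h k u)) (g u) < 1/4"
      unfolding eventually_sequentially by blast
    have big: "cmod (h k u) \<ge> 1" if "k \<ge> k0" "u \<in> cball w r" for k u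
    proof (rule ccontr)
      assume "\<not> cmod (h k u) \<ge> 1"
      hence "snd (to_sphere (h k u)) \<le> 1 - 2 / (1\<^sup>2 + 1)" by (intro snd_to_sphere_le) simp
      thus False using k0[OF that] g34[OF that(2)] snd_close[of "to_sphere (h k u)" "g u"] by simp
    qed
    define F where "F = (\<lambda>k u. 1 / h (k + k0) u)"
    have holF: "F k holomorphic_on ball w r" for k
      unfolding F_def
    proof (intro holomorphic_intros holomorphic_on_subset[OF h])
      show "ball w r \<subseteq> V" using r by auto
      show "h (k + k0) u \<noteq> 0" if "u \<in> ball w r" for u
        using big[of "k + k0" u] that by auto
    qed
    obtain G \<rho> where G: "G holomorphic_on ball w r" "strict_mono (\<rho> :: nat \<Rightarrow> nat)"
      "\<And>x. x \<in> ball w r \<Longrightarrow> (\<lambda>n. F (\<rho> n) x) \<longlonglongrightarrow> G x"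
      "\<And>K. compact K \<Longrightarrow> K \<subseteq> ball w r \<Longrightarrow> uniform_limit K (F \<circ> \<rho>) G sequentially"
    proof (rule Montel[of "ball w r" "range F" F])
      show "\<exists>B. \<forall>h\<in>range F. \<forall>z\<in>K. cmod (h z) \<le> B" if Kb: "compact K" "K \<subseteq> ball w r" for K
      proof (intro exI[of _ 1] ballI)
        fix f z assume "f \<in> range F" "z \<in> K"
        then obtain k where "f = F k" "z \<in> cball w r" using Kb by auto
        thus "cmod (f z) \<le> 1"
          using big[of "k + k0" z] by (auto simp: F_def norm_divide divide_le_eq_1)
      qed
    qed (use holF in auto)
    have Gg: "G u = cnj (fst (g u)) / of_real (1 + snd (g u))" if u: "u \<in> ball w r" for u
    proof (rule LIMSEQ_unique[OF G(3)[OF u]])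
      have uV: "u \<in> V" using u r by auto
      have "(\<lambda>k. to_sphere (h k u)) \<longlonglongrightarrow> g u"
        using uV by (intro tendsto_uniform_limitI[OF lim[of "{u}"]]) auto
      moreover have "filterlim (\<lambda>n. \<rho> n + k0) sequentially sequentially"
        by (rule filterlim_compose[OF filterlim_add_const_nat_at_top filterlim_subseq[OF G(2)]])
      ultimately have "(\<lambda>n. to_sphere (h (\<rho> n + k0) u)) \<longlonglongrightarrow> g u"
        by (rule filterlim_compose)
      moreover have "1 + snd (g u) \<noteq> 0" using g34[of u] u by auto
      ultimately have "(\<lambda>n. cnj (fst (to_sphere (h (\<rho> n + k0) u))) / of_real (1 + snd (to_sphere (h (\<rho> n + k0) u))))
           \<longlonglongrightarrow> cnj (fst (g u)) / of_real (1 + snd (g u))"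
        by (intro tendsto_intros) (auto simp: complex_eq_iff)
      moreover have "h (\<rho> n + k0) u \<noteq> 0" for n using big[of "\<rho> n + k0" u] u by auto
      ultimately show "(\<lambda>n. F (\<rho> n) u) \<longlonglongrightarrow> cnj (fst (g u)) / of_real (1 + snd (g u))"
        by (simp add: F_def inverse_via_sphere)
    qed
    have Gw: "G w = 0" using Gg[of w] r sphere[OF wV] gw by simp
    have "G constant_on ball w r"
    proof (rule ccontr)
      assume "\<not> G constant_on ball w r"
      hence "G w \<noteq> 0"
      proof (rule Hurwitz_no_zeros[of "ball w r" "F \<circ> \<rho>" G, rotated 5])
        show "(F \<circ> \<rho>) n z \<noteq> 0" if "z \<in> ball w r" for n z
          using big[of "\<rho> n + k0" z] that by (auto simp: F_def)
      qed (use holF G r in auto)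
      thus False using Gw by simp
    qed
    hence G0: "G u = 0" if "u \<in> ball w r" for u
      using Gw that r unfolding constant_on_def by (metis centre_in_ball)
    have "ball w r \<subseteq> N"
    proof
      fix u assume u: "u \<in> ball w r"
      have uV: "u \<in> V" using u r by auto
      have pos: "snd (g u) > 3/4" using g34[of u] u by auto
      hence "complex_of_real (1 + snd (g u)) \<noteq> 0" by (simp add: complex_eq_iff)
      hence "fst (g u) = 0" using G0[OF u] Gg[OF u] by simp
      hence "(snd (g u))\<^sup>2 = 1" using sphere[OF uV] by simp
      hence "snd (g u) = 1" using pos by (auto simp: power2_eq_1_iff)
      thus "u \<in> N" using uV by (simp add: N_def)
    qed
    thus ?thesis using r by blast
  qed
  hence "open N" by (meson open_contains_ball)
  hence "openin (top_of_set V) N" by (intro open_subset) (auto simp: N_def)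
  hence "N = {} \<or> N = V" using closed V(2) unfolding connected_clopen by blast
  moreover have "b \<notin> N" using b by (simp add: N_def)
  ultimately have "z \<notin> N" using b z by auto
  hence "snd (g z) \<noteq> 1" using z by (simp add: N_def)
  moreover have "snd (g z) \<le> 1"
    using sphere[OF z] by (smt (verit) power2_le_imp_le one_power2 zero_le_power2)
  ultimately show ?thesis by simp
qed

text \<open>
  One bounded point excludes the limit infinity, on which a spherically normal family could escape; so the
  family is normal in the ordinary sense.
\<close>

lemma normal_family_bounded:
  assumes V: "open V" "connected V" and normal: "normal_family_on F V"
      and hol: "\<And>h. h \<in> F \<Longrightarrow> h holomorphic_on V"
      and b: "b \<in> V" "\<And>h. h \<in> F \<Longrightarrow> cmod (h b) \<le> B"
      and K: "compact K" "K \<subseteq> V"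
  shows "\<exists>B'. \<forall>h\<in>F. \<forall>w\<in>K. cmod (h w) \<le> B'"
proof (rule ccontr)
  assume "\<not> ?thesis"
  hence "\<forall>i. \<exists>h w. h \<in> F \<and> w \<in> K \<and> cmod (h w) > real i"
    by (metis not_le)
  then obtain h w where hw: "\<And>i. h i \<in> F" "\<And>i. w i \<in> K" "\<And>i. cmod (h i (w i)) > real i"
    by metis
  obtain r g where r: "strict_mono (r :: nat \<Rightarrow> nat)" and g: "g ` V \<subseteq> riemann_sphere"
    and lim: "\<And>K. compact K \<Longrightarrow> K \<subseteq> V \<Longrightarrow> uniform_limit K (\<lambda>n z. to_sphere (h (r n) z)) g sequentially"
    using normal hw(1) unfolding normal_family_on_def by (metis image_subset_iff)
  have holr: "h (r n) holomorphic_on V" for n using hol hw by blast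
  have "(\<lambda>n. snd (to_sphere (h (r n) b))) \<longlonglongrightarrow> snd (g b)"
    using lim[of "{b}"] b by (intro tendsto_snd tendsto_uniform_limitI[OF lim[of "{b}"]]) auto
  hence "snd (g b) \<le> 1 - 2 / (B\<^sup>2 + 1)"
    by (rule LIMSEQ_le_const2) (use b hw snd_to_sphere_le in blast)
  moreover have "2 / (B\<^sup>2 + 1) > 0" by (intro divide_pos_pos add_nonneg_pos) auto
  ultimately have gb: "snd (g b) < 1" by linarith
  have fin: "snd (g z) < 1" if "z \<in> V" for z
    by (rule sphere_limit_finite[OF V holr g lim b(1) gb that])
  have cont: "continuous_on K (\<lambda>z. snd (g z))"
    by (intro continuous_intros continuous_on_subset[OF sphere_limit_continuous[OF V(1) holr lim]] K)
  have "K \<noteq> {}" using hw by auto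
  then obtain z where z: "z \<in> K" "\<And>y. y \<in> K \<Longrightarrow> snd (g y) \<le> snd (g z)"
    using continuous_attains_sup[OF K(1) _ cont] by blast
  define e where "e = (1 - snd (g z)) / 2"
  have e: "e > 0" using fin[of z] z K by (auto simp: e_def)
  have "\<forall>\<^sub>F k in sequentially. \<forall>u\<in>K. dist (to_sphere (h (r k) u)) (g u) < e"
    by (rule uniform_limitD[OF lim e]) (use K in auto)
  moreover have "\<forall>\<^sub>F k in sequentially. real k > 2 / e + 1"
    using filterlim_real_sequentially unfolding filterlim_at_top_dense by auto
  ultimately have "\<forall>\<^sub>F k in sequentially. (\<forall>u\<in>K. dist (to_sphere (h (r k) u)) (g u) < e) \<and> real k > 2 / e + 1"
    by (rule eventually_conj)
  from eventually_happens'[OF sequentially_bot this] obtain k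
    where k: "\<forall>u\<in>K. dist (to_sphere (h (r k) u)) (g u) < e" "real k > 2 / e + 1" by blast
  define u where "u = w (r k)"
  have "\<bar>snd (to_sphere (h (r k) u)) - snd (g u)\<bar> < e"
    using k(1) hw(2)[of "r k"] dist_snd_le[of "to_sphere (h (r k) u)" "g u"]
    by (fastforce simp: u_def dist_real_def)
  moreover have "snd (g u) \<le> snd (g z)" using z hw by (simp add: u_def)
  moreover have "snd (g z) + e = 1 - e" by (simp add: e_def field_simps)
  ultimately have "snd (to_sphere (h (r k) u)) < 1 - e" by linarith
  hence "(cmod (h (r k) u))\<^sup>2 < 2 / e" by (rule cmod_if_snd_to_sphere_less[OF _ e])
  moreover have "cmod (h (r k) u) > real k"
    using hw(3)[of "r k"] seq_suble[OF r, of k] by (simp add: u_def)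
  moreover have "2 / e > 0" using e by simp
  ultimately show False using k(2)
    by (smt (verit) power2_eq_square mult_le_cancel_left1 mult_less_cancel_left1)
qed

section \<open>Iteration on the immediate basin of a Siegel point\<close>

lemma iterates_holomorphic:
  assumes "f holomorphic_on U" "V \<subseteq> escape_free f U"
  shows "(f ^^ n) holomorphic_on V"
proof (induction n)
  case 0
  show ?case by (simp add: id_def)
next
  case (Suc n)
  have "(f \<circ> (f ^^ n)) holomorphic_on V"
    by (rule holomorphic_on_compose[OF Suc holomorphic_on_subset[OF assms(1)]])
       (use assms(2) in \<open>auto simp: escape_free_iff\<close>)
  thus ?case by (simp add: o_def)
qed

lemma open_fatou_set: "open (fatou_set f U)"
proof (subst open_contains_ball, intro ballI)
  fix z assume "z \<in> fatou_set f U"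
  then obtain V where V: "open V" "z \<in> V" "V \<subseteq> escape_free f U"
      "normal_family_on ((\<lambda>n. f ^^ n) ` {1..}) V"
    by (auto simp: fatou_set_def)
  hence "V \<subseteq> fatou_set f U"
    using interior_maximal[OF V(3,1)] by (auto simp: fatou_set_def)
  thus "\<exists>e>0. ball z e \<subseteq> fatou_set f U"
    using V(1,2) by (meson open_contains_ball subset_trans)
qed

text \<open>
  The image \<open>W\<close> of a small disc under the open map \<open>f\<close> is a neighbourhood of \<open>f z\<close>, and the \<open>n\<close>-th iterate
  on \<open>W\<close> is the \<open>(n+1)\<close>-st iterate on the disc. Hence a limit on \<open>W\<close> is obtained from one on
  the disc by composing with a right inverse of \<open>f\<close>; uniform
  convergence passes through the right inverse even where that is discontinuous.
\<close>

lemma fatou_set_invariant: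
  assumes U: "open U" "connected U" and hol: "f holomorphic_on U"
      and nc: "\<not> f constant_on U" and z: "z \<in> fatou_set f U"
  shows "f z \<in> fatou_set f U"
proof -
  obtain V where V: "open V" "z \<in> V" "V \<subseteq> escape_free f U"
      "normal_family_on ((\<lambda>n. f ^^ n) ` {1..}) V"
    using z by (auto simp: fatou_set_def)
  have VU: "V \<subseteq> U"
    using V(3) unfolding subset_iff escape_free_iff by (metis funpow_0)
  obtain r where r: "r > 0" "cball z r \<subseteq> V" using V open_contains_cball by blast
  define W where "W = f ` ball z r"
  have bV: "ball z r \<subseteq> V" using r by auto
  have W: "open W" unfolding W_def
    by (rule open_mapping_thm[OF hol U _ _ nc]) (use bV VU in auto)
  have fW: "f z \<in> W" using r by (auto simp: W_def)
  have Wesc: "W \<subseteq> escape_free f U"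
  proof
    fix w assume "w \<in> W"
    then obtain v where v: "v \<in> V" "w = f v" using bV by (auto simp: W_def)
    have "(f ^^ n) w \<in> U" for n
    proof -
      have "(f ^^ Suc n) v \<in> U" using v V(3) unfolding subset_iff escape_free_iff by blast
      thus ?thesis using v by (simp add: funpow_swap1)
    qed
    thus "w \<in> escape_free f U" by (simp add: escape_free_iff)
  qed
  have "normal_family_on ((\<lambda>n. f ^^ n) ` {1..}) W"
    unfolding normal_family_on_def
  proof (intro allI impI)
    fix h :: "nat \<Rightarrow> complex \<Rightarrow> complex" assume h: "range h \<subseteq> (\<lambda>n. f ^^ n) ` {1..}"
    hence "\<forall>i. \<exists>n. n \<ge> 1 \<and> h i = f ^^ n" by auto
    then obtain n where n: "\<And>i. n i \<ge> 1" "\<And>i. h i = f ^^ n i" by metis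
    define h' where "h' = (\<lambda>i. f ^^ Suc (n i))"
    have hh': "h' i v = h i (f v)" for i v by (simp add: h'_def n funpow_swap1)
    have "range h' \<subseteq> (\<lambda>n. f ^^ n) ` {1..}" by (auto simp: h'_def simp del: funpow.simps)
    then obtain s g where s: "strict_mono (s :: nat \<Rightarrow> nat)" and g: "g ` V \<subseteq> riemann_sphere"
      and lim: "\<And>K. compact K \<Longrightarrow> K \<subseteq> V \<Longrightarrow> uniform_limit K (\<lambda>n z. to_sphere (h' (s n) z)) g sequentially"
      using V(4) unfolding normal_family_on_def by metis
    define c where "c = inv_into (ball z r) f"
    have c: "c w \<in> ball z r" "f (c w) = w" if "w \<in> W" for w
      using that unfolding W_def c_def by (rule inv_into_into, rule f_inv_into_f)
    have ul: "uniform_limit (cball z r) (\<lambda>n z. to_sphere (h' (s n) z)) g sequentially"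
      using lim r by auto
    have ulW: "uniform_limit W (\<lambda>n w. to_sphere (h (s n) w)) (\<lambda>w. g (c w)) sequentially"
    proof (rule uniform_limitI)
      fix e :: real assume "e > 0"
      from uniform_limitD[OF ul this]
      show "\<forall>\<^sub>F n in sequentially. \<forall>w\<in>W. dist (to_sphere (h (s n) w)) (g (c w)) < e"
      proof eventually_elim
        case (elim n)
        show ?case
        proof
          fix w assume w: "w \<in> W"
          have "dist (to_sphere (h' (s n) (c w))) (g (c w)) < e" using elim c[OF w] by auto
          thus "dist (to_sphere (h (s n) w)) (g (c w)) < e" using c[OF w] by (simp add: hh')
        qed
      qed
    qed
    show "\<exists>(r :: nat \<Rightarrow> nat) g. strict_mono r \<and> g ` W \<subseteq> riemann_sphere \<and>
           (\<forall>K. compact K \<and> K \<subseteq> W \<longrightarrow>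
              uniform_limit K (\<lambda>n z. to_sphere (h (r n) z)) g sequentially)"
    proof (intro exI[of _ s] exI[of _ "\<lambda>w. g (c w)"] conjI allI impI)
      show "(\<lambda>w. g (c w)) ` W \<subseteq> riemann_sphere"
        using g c(1) bV by blast
      fix K assume "compact K \<and> K \<subseteq> W"
      thus "uniform_limit K (\<lambda>n z. to_sphere (h (s n) z)) (\<lambda>w. g (c w)) sequentially"
        using uniform_limit_on_subset[OF ulW] by blast
    qed (rule s)
  qed
  thus ?thesis
    using W fW Wesc interior_maximal[OF Wesc W] by (auto simp: fatou_set_def)
qed

locale siegel_basin =
  fixes f :: "complex \<Rightarrow> complex" and U :: "complex set" and z0 :: complex
  assumes openU: "open U" and connU: "connected U" and holf: "f holomorphic_on U"
      and siegel: "siegel_point f U z0"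
begin

definition S :: "complex set" where "S = immediate_basin z0 f U"

definition l :: complex where "l = deriv f z0"

lemma z0U: "z0 \<in> U" and fz0 [simp]: "f z0 = z0" and norm_l: "cmod l = 1"
  using siegel by (auto simp: siegel_point_def irrationally_neutral_def neutral_def fixed_point_def l_def)

lemma l_power_ne_1: "k \<ge> 1 \<Longrightarrow> l ^ k \<noteq> 1"
  using siegel cis_rational_if_power_eq_1[OF norm_l]
  by (auto simp: siegel_point_def irrationally_neutral_def parabolic_def l_def)

lemma l_power_inj:
  assumes "l ^ j = l ^ k"
  shows "j = k"
proof -
  have *: "j = k" if "j \<le> k" "l ^ j = l ^ k" for j k
  proof -
    have "l ^ j * l ^ (k - j) = l ^ k" using that(1) by (metis le_add_diff_inverse power_add)
    moreover have "l ^ j \<noteq> 0" using norm_l by auto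
    ultimately have "l ^ (k - j) = 1" using that(2) by (metis mult_cancel_left2)
    hence "\<not> k - j \<ge> 1" using l_power_ne_1 by blast
    thus ?thesis using that(1) by simp
  qed
  show ?thesis using *[of j k] *[of k j] assms by (cases "j \<le> k") auto
qed

lemma z0S: "z0 \<in> S"
  using siegel by (simp add: S_def immediate_basin_def siegel_point_def)

lemma S_fatou: "S \<subseteq> fatou_set f U"
  by (simp add: S_def immediate_basin_def connected_component_subset)

lemma openS: "open S"
  by (simp add: S_def immediate_basin_def open_connected_component open_fatou_set)

lemma connS: "connected S"
  by (simp add: S_def immediate_basin_def)

lemma S_escape_free: "S \<subseteq> escape_free f U"
  using S_fatou interior_subset by (fastforce simp: fatou_set_def)

lemma S_U: "S \<subseteq> U"
  using S_escape_free unfolding subset_iff escape_free_iff by (metis funpow_0)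

lemma hol_iter: "(f ^^ n) holomorphic_on S"
  by (rule iterates_holomorphic[OF holf S_escape_free])

lemma DERIV_f_z0: "(f has_field_derivative l) (at z0)"
  unfolding l_def by (rule holomorphic_derivI[OF holf openU z0U])

lemma f_nonconstant: "\<not> f constant_on U"
proof
  assume "f constant_on U"
  then obtain c where "\<And>z. z \<in> U \<Longrightarrow> f z = c" by (auto simp: constant_on_def)
  hence "(f has_field_derivative 0) (at z0) = ((\<lambda>z. c) has_field_derivative 0) (at z0)"
    by (intro DERIV_cong_ev refl) (use eventually_nhds_in_open[OF openU z0U] in \<open>auto elim: eventually_mono\<close>)
  hence "(f has_field_derivative 0) (at z0)" by simp
  hence "l = 0" using DERIV_f_z0 DERIV_unique by blast
  thus False using norm_l by simp
qed

lemma f_S: "z \<in> S \<Longrightarrow> f z \<in> S"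
proof -
  assume z: "z \<in> S"
  have "f ` S \<subseteq> fatou_set f U"
    using fatou_set_invariant[OF openU connU holf f_nonconstant] S_fatou by auto
  moreover have "connected (f ` S)"
    by (intro connected_continuous_image connS holomorphic_on_imp_continuous_on
          holomorphic_on_subset[OF holf S_U])
  moreover have "z0 \<in> f ` S" using z0S fz0 by force
  ultimately have "f ` S \<subseteq> S"
    unfolding S_def immediate_basin_def by (simp add: connected_component_maximal)
  thus "f z \<in> S" using z by auto
qed

lemma iter_S: "z \<in> S \<Longrightarrow> (f ^^ n) z \<in> S"
  by (induction n) (auto intro: f_S)

lemma iter_z0 [simp]: "(f ^^ n) z0 = z0"
  by (induction n) auto

lemma DERIV_iter_z0: "((f ^^ n) has_field_derivative l ^ n) (at z0)"
proof (induction n)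
  case 0
  show ?case by (simp add: id_def)
next
  case (Suc n)
  have "(f \<circ> (f ^^ n) has_field_derivative l * l ^ n) (at z0)"
    by (rule DERIV_chain[OF _ Suc]) (use DERIV_f_z0 in simp)
  thus ?case by (simp add: o_def)
qed

text \<open>
  On a small disc in the basin either all orbits are unbounded or the iterates are locally bounded; this
  dichotomy propagates boundedness from \<open>z0\<close> through the connected basin.
\<close>

lemma local_bound:
  assumes z: "z \<in> S"
  obtains r where "r > 0" "ball z r \<subseteq> S"
    "\<And>b B K. b \<in> ball z r \<Longrightarrow> (\<And>n. n \<ge> 1 \<Longrightarrow> cmod ((f ^^ n) b) \<le> B) \<Longrightarrow> compact K \<Longrightarrow> K \<subseteq> ball z r \<Longrightarrow>
       \<exists>B'. \<forall>n\<ge>1. \<forall>w\<in>K. cmod ((f ^^ n) w) \<le> B'"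
proof -
  have "z \<in> fatou_set f U" using z S_fatou by auto
  then obtain V where V: "open V" "z \<in> V" "V \<subseteq> escape_free f U"
      "normal_family_on ((\<lambda>n. f ^^ n) ` {1..}) V"
    by (auto simp: fatou_set_def)
  obtain r where r: "r > 0" "ball z r \<subseteq> V \<inter> S"
    using V(1,2) openS z by (meson IntI open_Int open_contains_ball)
  show ?thesis
  proof (rule that[of r])
    fix b B K assume b: "b \<in> ball z r" "\<And>n. n \<ge> 1 \<Longrightarrow> cmod ((f ^^ n) b) \<le> B"
      and K: "compact K" "K \<subseteq> ball z r"
    have "\<exists>B'. \<forall>h\<in>(\<lambda>n. f ^^ n) ` {1..}. \<forall>w\<in>K. cmod (h w) \<le> B'"
    proof (rule normal_family_bounded[of "ball z r" _ b B K])
      show "normal_family_on ((\<lambda>n. f ^^ n) ` {1..}) (ball z r)"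
        by (rule normal_family_on_subset[OF V(4)]) (use r in auto)
      show "h holomorphic_on ball z r" if "h \<in> (\<lambda>n. f ^^ n) ` {1..}" for h
        using that r by (auto intro: holomorphic_on_subset[OF hol_iter])
    qed (use b K in auto)
    thus "\<exists>B'. \<forall>n\<ge>1. \<forall>w\<in>K. cmod ((f ^^ n) w) \<le> B'" by auto
  qed (use r in auto)
qed

lemma orbit_bounded:
  assumes z: "z \<in> S"
  shows "\<exists>B. \<forall>n\<ge>1. cmod ((f ^^ n) z) \<le> B"
proof -
  define T where "T = {z \<in> S. \<exists>B. \<forall>n\<ge>1. cmod ((f ^^ n) z) \<le> B}"
  have all_or_none: "\<exists>r>0. ball z r \<subseteq> S \<and> (ball z r \<subseteq> T \<or> ball z r \<inter> T = {})" if z: "z \<in> S" for z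
  proof -
    obtain r where r: "r > 0" "ball z r \<subseteq> S"
      "\<And>b B K. b \<in> ball z r \<Longrightarrow> (\<And>n. n \<ge> 1 \<Longrightarrow> cmod ((f ^^ n) b) \<le> B) \<Longrightarrow> compact K \<Longrightarrow> K \<subseteq> ball z r \<Longrightarrow>
         \<exists>B'. \<forall>n\<ge>1. \<forall>w\<in>K. cmod ((f ^^ n) w) \<le> B'"
      using local_bound[OF z] by blast
    have "ball z r \<subseteq> T" if b: "b \<in> ball z r" "b \<in> T" for b
    proof
      fix w assume w: "w \<in> ball z r"
      obtain B where "\<And>n. n \<ge> 1 \<Longrightarrow> cmod ((f ^^ n) b) \<le> B" using b by (auto simp: T_def)
      from r(3)[OF b(1) this, of "{w}"] w show "w \<in> T" using r(2) by (auto simp: T_def)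
    qed
    thus ?thesis using r(1,2) by blast
  qed
  have "openin (top_of_set S) T" "openin (top_of_set S) (S - T)"
  proof -
    have "open T" unfolding open_contains_ball
    proof
      fix x assume x: "x \<in> T"
      hence "x \<in> S" by (simp add: T_def)
      from all_or_none[OF this] x show "\<exists>e>0. ball x e \<subseteq> T"
        by (metis IntI centre_in_ball empty_iff)
    qed
    moreover have "open (S - T)" unfolding open_contains_ball
    proof
      fix x assume x: "x \<in> S - T"
      then obtain r where "r > 0" "ball x r \<subseteq> S" "ball x r \<subseteq> T \<or> ball x r \<inter> T = {}"
        using all_or_none[of x] by auto
      thus "\<exists>e>0. ball x e \<subseteq> S - T" using x centre_in_ball[of x r] by (intro exI[of _ r]) blast
    qed
    ultimately show "openin (top_of_set S) T" "openin (top_of_set S) (S - T)"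
      by (auto intro: open_subset simp: T_def)
  qed
  hence "closedin (top_of_set S) T"
    by (simp add: closedin_def T_def Collect_restrict)
  with \<open>openin (top_of_set S) T\<close> have "T = {} \<or> T = S"
    using connS unfolding connected_clopen by blast
  moreover have "z0 \<in> T" using z0S by (auto simp: T_def)
  ultimately show ?thesis using z by (auto simp: T_def)
qed

lemma compact_bounded:
  assumes K: "compact K" "K \<subseteq> S"
  shows "\<exists>B. \<forall>n. \<forall>z\<in>K. cmod ((f ^^ n) z) \<le> B"
proof -
  have "\<exists>r>0. \<exists>B. \<forall>n. \<forall>w\<in>ball z r. cmod ((f ^^ n) w) \<le> B" if z: "z \<in> K" for z
  proof -
    have zS: "z \<in> S" using z K by auto
    obtain r where r: "r > 0" "ball z r \<subseteq> S"
      "\<And>b B K. b \<in> ball z r \<Longrightarrow> (\<And>n. n \<ge> 1 \<Longrightarrow> cmod ((f ^^ n) b) \<le> B) \<Longrightarrow> compact K \<Longrightarrow> K \<subseteq> ball z r \<Longrightarrow>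
         \<exists>B'. \<forall>n\<ge>1. \<forall>w\<in>K. cmod ((f ^^ n) w) \<le> B'"
      using local_bound[OF zS] by blast
    obtain B where "\<And>n. n \<ge> 1 \<Longrightarrow> cmod ((f ^^ n) z) \<le> B" using orbit_bounded[OF zS] by auto
    hence "\<exists>B'. \<forall>n\<ge>1. \<forall>w\<in>cball z (r/2). cmod ((f ^^ n) w) \<le> B'"
      using r by (intro r(3)) auto
    then obtain B' where B': "\<And>n w. n \<ge> 1 \<Longrightarrow> w \<in> cball z (r/2) \<Longrightarrow> cmod ((f ^^ n) w) \<le> B'" by blast
    have bd: "cmod ((f ^^ n) w) \<le> max B' (cmod z + r)" if w: "w \<in> ball z (r/2)" for n w
    proof (cases "n = 0")
      case True
      have "cmod w \<le> cmod z + dist z w"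
        using norm_triangle_sub[of w z] by (simp add: dist_norm norm_minus_commute)
      thus ?thesis using True w r by auto
    next
      case False
      thus ?thesis using B'[of n w] w by auto
    qed
    thus ?thesis using r(1)
      by (intro exI[of _ "r/2"] exI[of _ "max B' (cmod z + r)"] conjI allI ballI) auto
  qed
  then obtain r B where rB: "\<And>z. z \<in> K \<Longrightarrow> r z > 0"
     "\<And>z n w. z \<in> K \<Longrightarrow> w \<in> ball z (r z) \<Longrightarrow> cmod ((f ^^ n) w) \<le> B z"
    by metis
  obtain C where C: "C \<subseteq> K" "finite C" "K \<subseteq> (\<Union>c\<in>C. ball c (r c))"
    by (rule compactE_image[OF K(1), of K "\<lambda>z. ball z (r z)"]) (use rB(1) in force)+
  have "cmod ((f ^^ n) z) \<le> (\<Sum>c\<in>C. \<bar>B c\<bar>)" if z: "z \<in> K" for n z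
  proof -
    obtain c where c: "c \<in> C" "z \<in> ball c (r c)" using C z by auto
    have "cmod ((f ^^ n) z) \<le> \<bar>B c\<bar>" using rB(2)[of c z n] c C by force
    also have "\<dots> \<le> (\<Sum>c\<in>C. \<bar>B c\<bar>)" by (rule member_le_sum) (use c C in auto)
    finally show ?thesis .
  qed
  thus ?thesis by blast
qed

text \<open>
  Compact sets do not drift to the boundary of the basin under iteration. If points of the iterated images
  of \<open>K\<close> converged to \<open>p\<close> outside \<open>S\<close>, then a limit \<open>G\<close> of the corresponding iterates would be
  nonconstant, since \<open>\<bar>G'(z\<^sub>0)\<bar> = 1\<close>, and would omit \<open>p\<close> by Hurwitz' theorem, because all iterates map \<open>S\<close> into
  itself. But \<open>p\<close> would be a value of \<open>G\<close> on \<open>K\<close>.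
\<close>

lemma orbit_closure_compact:
  assumes K: "compact K" "K \<subseteq> S"
  obtains L where "compact L" "L \<subseteq> S" "\<And>z n. z \<in> K \<Longrightarrow> (f ^^ n) z \<in> L"
proof -
  define L where "L = closure (\<Union>n. (f ^^ n) ` K)"
  obtain B where B: "\<And>n z. z \<in> K \<Longrightarrow> cmod ((f ^^ n) z) \<le> B" using compact_bounded[OF K] by auto
  have "bounded (\<Union>n. (f ^^ n) ` K)"
    by (rule boundedI[of _ B]) (use B in auto)
  hence "compact L" unfolding L_def by (simp add: compact_closure)
  moreover have "L \<subseteq> S"
  proof
    fix p assume "p \<in> L"
    then obtain x where x: "\<And>i. x i \<in> (\<Union>n. (f ^^ n) ` K)" "x \<longlonglongrightarrow> p"
      unfolding L_def closure_sequential by auto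
    have "\<forall>i. \<exists>n z. z \<in> K \<and> x i = (f ^^ n) z"
    proof
      fix i show "\<exists>n z. z \<in> K \<and> x i = (f ^^ n) z" using x(1)[of i] by auto
    qed
    then obtain n z where nz: "\<And>i. z i \<in> K" "\<And>i. x i = (f ^^ n i) (z i)" by metis
    obtain G r where G: "G holomorphic_on S" "strict_mono (r :: nat \<Rightarrow> nat)"
      "\<And>y. y \<in> S \<Longrightarrow> (\<lambda>i. (f ^^ n (r i)) y) \<longlonglongrightarrow> G y"
      "\<And>K. compact K \<Longrightarrow> K \<subseteq> S \<Longrightarrow> uniform_limit K ((\<lambda>i. f ^^ n i) \<circ> r) G sequentially"
    proof (rule Montel[OF openS, of "range (\<lambda>n. f ^^ n)" "\<lambda>i. f ^^ n i"])
      show "\<exists>B. \<forall>h\<in>range (\<lambda>n. f ^^ n). \<forall>z\<in>K. cmod (h z) \<le> B" if "compact K" "K \<subseteq> S" for K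
        using compact_bounded[OF that] by blast
    qed (use hol_iter in auto)
    show "p \<in> S"
    proof (rule ccontr)
      assume p: "p \<notin> S"
      obtain d where d: "d > 0" "cball z0 d \<subseteq> S" using openS z0S open_contains_cball by blast
      have "(\<lambda>i. deriv (((\<lambda>i. f ^^ n i) \<circ> r) i) z0) \<longlonglongrightarrow> deriv G z0"
      proof (rule deriv_complex_uniform_limit[where A = "ball z0 d"])
        show "uniform_limit (ball z0 d) ((\<lambda>i. f ^^ n i) \<circ> r) G sequentially"
          by (rule uniform_limit_on_subset[OF G(4)[of "cball z0 d"]]) (use d in auto)
        show "\<forall>\<^sub>F i in sequentially. ((\<lambda>i. f ^^ n i) \<circ> r) i holomorphic_on ball z0 d"
          using d by (intro always_eventually) (auto intro!: holomorphic_on_subset[OF hol_iter])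
      qed (use d in auto)
      hence "(\<lambda>i. cmod (l ^ n (r i))) \<longlonglongrightarrow> cmod (deriv G z0)"
        by (intro tendsto_norm) (simp add: DERIV_imp_deriv[OF DERIV_iter_z0])
      hence "cmod (deriv G z0) = 1"
        by (simp add: norm_power norm_l LIMSEQ_const_iff)
      moreover have "deriv G z0 = 0" if Gc: "G constant_on S"
      proof -
        obtain c where c: "\<And>z. z \<in> S \<Longrightarrow> G z = c" using Gc by (auto simp: constant_on_def)
        have "deriv G z0 = deriv (\<lambda>z. c) z0"
          using c eventually_nhds_in_open[OF openS z0S]
          by (intro deriv_cong_ev refl) (auto elim: eventually_mono)
        thus ?thesis by simp
      qed
      ultimately have nc: "\<not> G constant_on S" by fastforce
      have nz: "G y - p \<noteq> 0" if y: "y \<in> S" for y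
      proof (rule Hurwitz_no_zeros[OF openS connS, of "\<lambda>i y. (f ^^ n (r i)) y - p" "\<lambda>y. G y - p"])
        show "uniform_limit K (\<lambda>i y. (f ^^ n (r i)) y - p) (\<lambda>y. G y - p) sequentially"
          if "compact K" "K \<subseteq> S" for K
          using G(4)[OF that] by (intro uniform_limit_intros) (auto simp: o_def)
        show "\<not> (\<lambda>y. G y - p) constant_on S"
          using nc unfolding constant_on_def by (metis diff_add_cancel)
        show "(f ^^ n (r i)) y - p \<noteq> 0" if "y \<in> S" for i y
          using iter_S[OF that] p by (metis eq_iff_diff_eq_0)
      qed (use G(1) hol_iter y in \<open>auto intro!: holomorphic_intros\<close>)
      have ne: "K \<noteq> {}" using nz(1) \<open>\<And>i. z i \<in> K\<close> by auto
      have "continuous_on K (\<lambda>y. cmod (G y - p))"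
        by (intro continuous_intros holomorphic_on_imp_continuous_on holomorphic_on_subset[OF G(1)] K)
      then obtain y where y: "y \<in> K" "\<And>w. w \<in> K \<Longrightarrow> cmod (G y - p) \<le> cmod (G w - p)"
        using continuous_attains_inf[OF K(1) ne] by blast
      define e where "e = cmod (G y - p)"
      have e: "e > 0" using nz[of y] y K by (auto simp: e_def)
      have "\<forall>\<^sub>F i in sequentially. \<forall>w\<in>K. dist (((\<lambda>i. f ^^ n i) \<circ> r) i w) (G w) < e / 2"
        by (rule uniform_limitD[OF G(4)[OF K]]) (use e in simp)
      moreover have "(\<lambda>i. x (r i)) \<longlonglongrightarrow> p"
        using LIMSEQ_subseq_LIMSEQ[OF x(2) G(2)] by (simp add: o_def)
      hence "\<forall>\<^sub>F i in sequentially. dist (x (r i)) p < e / 2"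
        by (rule tendstoD) (use e in simp)
      ultimately have "\<forall>\<^sub>F i in sequentially. False"
      proof eventually_elim
        case (elim i)
        have "dist (x (r i)) (G (z (r i))) < e / 2"
          using elim(1) \<open>\<And>i. z i \<in> K\<close>[of "r i"] \<open>\<And>i. x i = (f ^^ n i) (z i)\<close> by simp
        moreover have "e \<le> cmod (G (z (r i)) - p)" using y(2)[OF \<open>\<And>i. z i \<in> K\<close>] by (simp add: e_def)
        moreover have "cmod (G (z (r i)) - p) \<le> dist (x (r i)) (G (z (r i))) + dist (x (r i)) p"
          using dist_triangle3[of "G (z (r i))" p "x (r i)"] by (simp add: dist_norm)
        ultimately show False using elim(2) by linarith
      qed
      thus False by simp
    qed
  qed
  moreover have "(f ^^ n) z \<in> L" if "z \<in> K" for z n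
    using that closure_subset by (force simp: L_def)
  ultimately show ?thesis using that by blast
qed

end

section \<open>The Koenigs function of a Siegel point is a conformal map onto a disc\<close>

lemma higher_deriv_rotation_sum:
  fixes F :: "complex \<Rightarrow> complex"
  assumes F: "F holomorphic_on ball 0 r" and r: "r > 0" and l: "cmod l = 1"
  shows "(deriv ^^ i) (\<lambda>w. \<Sum>j<m. d ^ j * F (l ^ j * w)) 0 = (\<Sum>j<m. (d * l ^ i) ^ j) * (deriv ^^ i) F 0"
proof (induction m)
  case 0
  show ?case by (induction i) (auto simp: higher_deriv_const)
next
  case (Suc m)
  have ball: "u * w \<in> ball 0 r" if "cmod u = 1" "w \<in> ball 0 r" for u w :: complex
    using that by (simp add: norm_mult)
  have lj: "cmod (l ^ j) = 1" for j using l by (simp add: norm_power)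
  have holj: "(\<lambda>w. F (l ^ j * w)) holomorphic_on ball 0 r" for j
  proof -
    have "(F \<circ> (\<lambda>w. l ^ j * w)) holomorphic_on ball 0 r"
      by (rule holomorphic_on_compose[OF _ holomorphic_on_subset[OF F]])
         (use ball lj in \<open>auto intro!: holomorphic_intros\<close>)
    thus ?thesis by (simp add: o_def)
  qed
  have "(deriv ^^ i) (\<lambda>w. (\<Sum>j<m. d ^ j * F (l ^ j * w)) + d ^ m * F (l ^ m * w)) 0 =
        (deriv ^^ i) (\<lambda>w. \<Sum>j<m. d ^ j * F (l ^ j * w)) 0 + (deriv ^^ i) (\<lambda>w. d ^ m * F (l ^ m * w)) 0"
    by (rule higher_deriv_add[of _ "ball 0 r"]) (use r holj in \<open>auto intro!: holomorphic_intros\<close>)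
  also have "(deriv ^^ i) (\<lambda>w. d ^ m * F (l ^ m * w)) 0 = d ^ m * (deriv ^^ i) (\<lambda>w. F (l ^ m * w)) 0"
    by (rule higher_deriv_cmult[OF holj]) (use r in auto)
  also have "(deriv ^^ i) (\<lambda>w. F (l ^ m * w)) 0 = (l ^ m) ^ i * (deriv ^^ i) F (l ^ m * 0)"
    by (rule higher_deriv_compose_linear[OF F, of "ball 0 r"]) (use r ball lj in auto)
  finally show ?case
    using Suc by (simp add: algebra_simps power_mult_distrib flip: power_mult)
qed

lemma open_larger_norm:
  fixes A :: "complex set"
  assumes "open A" "a \<in> A"
  shows "\<exists>b\<in>A. cmod a < cmod b"
proof -
  obtain e where e: "e > 0" "ball a e \<subseteq> A" using assms open_contains_ball by blast
  define u where "u = (if a = 0 then 1 else sgn a)"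
  have u: "cmod u = 1" "a = of_real (cmod a) * u"
    by (simp add: u_def norm_sgn) (simp add: u_def sgn_eq)
  define b where "b = a + of_real (e / 2) * u"
  have "b = of_real (cmod a + e / 2) * u"
    unfolding b_def of_real_add by (subst u(2)) (simp add: algebra_simps)
  hence "cmod b = cmod a + e / 2" using u(1) e(1) by (simp only: norm_mult norm_of_real) simp
  moreover have "dist a b < e"
    using e u by (simp add: b_def dist_norm norm_mult)
  ultimately show ?thesis using e by (intro bexI[of _ b]) auto
qed

locale siegel_linearization = siegel_basin +
  fixes \<phi> :: "complex \<Rightarrow> complex"
  assumes koenigs: "is_koenigs_function f U z0 \<phi>"
begin

lemma hol_\<phi>: "\<phi> holomorphic_on S" and deriv_\<phi>: "deriv \<phi> z0 = 1"
  using koenigs by (auto simp: is_koenigs_function_def S_def)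

lemma \<phi>_nonconstant: "\<not> \<phi> constant_on S"
proof
  assume "\<phi> constant_on S"
  then obtain c where c: "\<And>z. z \<in> S \<Longrightarrow> \<phi> z = c" by (auto simp: constant_on_def)
  have "deriv \<phi> z0 = deriv (\<lambda>z. c) z0"
    using c eventually_nhds_in_open[OF openS z0S]
    by (intro deriv_cong_ev refl) (auto elim: eventually_mono)
  thus False using deriv_\<phi> by simp
qed

lemma schroeder:
  assumes "z \<in> S"
  shows "\<phi> (f z) = l * \<phi> z"
proof -
  have "\<forall>\<^sub>F z in nhds z0. \<phi> (f z) = l * \<phi> z"
    using koenigs by (simp add: is_koenigs_function_def l_def)
  then obtain T where T: "open T" "z0 \<in> T" "\<And>z. z \<in> T \<Longrightarrow> \<phi> (f z) = l * \<phi> z"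
    by (auto simp: eventually_nhds)
  have "(\<phi> \<circ> f) holomorphic_on S"
    by (rule holomorphic_on_compose[OF holomorphic_on_subset[OF holf S_U] holomorphic_on_subset[OF hol_\<phi>]])
       (use f_S in auto)
  hence hol: "(\<lambda>z. \<phi> (f z)) holomorphic_on S" by (simp add: o_def)
  show ?thesis
    by (rule analytic_continuation_open[of "T \<inter> S" S "\<lambda>z. \<phi> (f z)" "\<lambda>z. l * \<phi> z"])
       (use T openS z0S connS hol hol_\<phi> assms in \<open>auto intro!: holomorphic_intros\<close>)
qed

lemma \<phi>_z0: "\<phi> z0 = 0"
proof -
  have "(1 - l) * \<phi> z0 = 0" using schroeder[OF z0S] by (simp add: algebra_simps)
  moreover have "l \<noteq> 1" using l_power_ne_1[of 1] by auto
  ultimately show ?thesis by simp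
qed

lemma schroeder_iter: "z \<in> S \<Longrightarrow> \<phi> ((f ^^ n) z) = l ^ n * \<phi> z"
  by (induction n) (auto simp: schroeder iter_S)

text \<open>
  The ball is taken so small that \<open>f \<circ> \<zeta>\<close> maps it into the region where \<open>\<phi>\<close> is injective; there the
  Schroeder equation for \<open>\<phi>\<close> turns into the conjugacy of \<open>f\<close> to the rotation by \<open>l\<close>.
\<close>

lemma local_inverse:
  obtains r \<zeta> W where "r > 0" "\<zeta> holomorphic_on ball 0 r" "\<And>w. w \<in> ball 0 r \<Longrightarrow> \<zeta> w \<in> S"
    "\<And>w. w \<in> ball 0 r \<Longrightarrow> f (\<zeta> w) = \<zeta> (l * w)"
    "open W" "z0 \<in> W" "W \<subseteq> S" "\<And>z. z \<in> W \<Longrightarrow> \<phi> z \<in> ball 0 r \<and> \<zeta> (\<phi> z) = z"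
proof -
  obtain s where s: "s > 0" "ball z0 s \<subseteq> S" "inj_on \<phi> (ball z0 s)"
    using has_complex_derivative_locally_injective[OF hol_\<phi> z0S openS] deriv_\<phi> by auto
  have hols: "\<phi> holomorphic_on ball z0 s" using hol_\<phi> s holomorphic_on_subset by blast
  obtain \<zeta> where \<zeta>: "\<zeta> holomorphic_on (\<phi> ` ball z0 s)" "\<And>z. z \<in> ball z0 s \<Longrightarrow> \<zeta> (\<phi> z) = z"
    using holomorphic_has_inverse[OF hols open_ball s(3)] by metis
  have op: "open (\<phi> ` ball z0 s)" by (rule open_mapping_thm3[OF hols open_ball s(3)])
  have "0 \<in> \<phi> ` ball z0 s" using \<phi>_z0 s by force
  then obtain r0 where r0: "r0 > 0" "ball 0 r0 \<subseteq> \<phi> ` ball z0 s"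
    using op open_contains_ball by blast
  have \<zeta>0: "\<zeta> 0 = z0" using \<zeta>(2)[of z0] s \<phi>_z0 by simp
  have \<zeta>S: "\<zeta> w \<in> ball z0 s" "\<phi> (\<zeta> w) = w" if "w \<in> ball 0 r0" for w
    using that r0 \<zeta>(2) by auto
  have hol\<zeta>: "\<zeta> holomorphic_on ball 0 r0" using holomorphic_on_subset[OF \<zeta>(1) r0(2)] .
  have "isCont (\<lambda>w. f (\<zeta> w)) 0"
  proof (rule isCont_o2[where f = \<zeta> and g = f])
    show "isCont \<zeta> 0" using holomorphic_on_imp_continuous_on[OF hol\<zeta>] r0(1)
      by (simp add: continuous_on_eq_continuous_at)
    show "isCont f (\<zeta> 0)" using DERIV_f_z0 DERIV_isCont \<zeta>0 by simp
  qed
  then obtain d where d: "d > 0" "\<And>w. dist w 0 < d \<Longrightarrow> dist (f (\<zeta> w)) (f (\<zeta> 0)) < s"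
    unfolding continuous_at_eps_delta using s(1) by metis
  define r where "r = min r0 d"
  have r: "r > 0" "r \<le> r0" "r \<le> d" using r0 d by (auto simp: r_def)
  show ?thesis
  proof (rule that[of r \<zeta> "ball z0 s \<inter> \<phi> -` ball 0 r"])
    show "\<zeta> holomorphic_on ball 0 r" using holomorphic_on_subset[OF hol\<zeta> subset_ball[OF r(2)]] .
    show "\<zeta> w \<in> S" if "w \<in> ball 0 r" for w using \<zeta>S(1)[of w] that r s by auto
    show "f (\<zeta> w) = \<zeta> (l * w)" if w: "w \<in> ball 0 r" for w
    proof -
      have w0: "w \<in> ball 0 r0" using w r by auto
      have "f (\<zeta> w) \<in> ball z0 s" using d(2)[of w] w r \<zeta>0 by (auto simp: dist_commute)
      hence "\<zeta> (\<phi> (f (\<zeta> w))) = f (\<zeta> w)" by (rule \<zeta>(2))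
      moreover have "\<phi> (f (\<zeta> w)) = l * w"
        using schroeder[of "\<zeta> w"] \<zeta>S[OF w0] s by auto
      ultimately show ?thesis by simp
    qed
    show "open (ball z0 s \<inter> \<phi> -` ball 0 r)"
      by (intro continuous_open_preimage holomorphic_on_imp_continuous_on hols) auto
  qed (use r s \<phi>_z0 \<zeta>(2) in auto)
qed

text \<open>
  The functions \<open>A n\<close> are the Cesaro means of \<open>l\<^sup>-\<^sup>j\<^sup>k f\<^sup>j\<close>. In the coordinate \<open>w\<close> the \<open>j\<close>-th term is
  \<open>l\<^sup>-\<^sup>j\<^sup>k \<zeta>(l\<^sup>j w)\<close>, so the mean keeps the \<open>k\<close>-th Taylor coefficient of \<open>\<zeta>\<close> and multiplies the \<open>i\<close>-th one by
  a mean of powers of \<open>l\<^sup>i\<^sup>-\<^sup>k\<close>, which tends to \<open>0\<close> for \<open>i \<noteq> k\<close> as \<open>l\<close> is not a root of unity. Any limit \<open>G\<close>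
  of the means is thus \<open>b \<phi>\<^sup>k\<close> near \<open>z\<^sub>0\<close>, and on \<open>S\<close> by analytic continuation. At \<open>z\<close> it is bounded
  by the supremum of the orbit of \<open>z\<close>. The point of the lemma is that \<open>z\<close> may be far from \<open>z\<^sub>0\<close>: it controls the
  radius of convergence of \<open>\<zeta>\<close> by the values of \<open>\<phi>\<close> on all of \<open>S\<close>.
\<close>

lemma Cesaro_coefficient_bound:
  assumes r: "r > 0" and hol\<zeta>: "\<zeta> holomorphic_on ball 0 r" and \<zeta>S: "\<And>w. w \<in> ball 0 r \<Longrightarrow> \<zeta> w \<in> S"
    and conj: "\<And>w. w \<in> ball 0 r \<Longrightarrow> f (\<zeta> w) = \<zeta> (l * w)"
    and W: "open W" "z0 \<in> W" "W \<subseteq> S" "\<And>z. z \<in> W \<Longrightarrow> \<phi> z \<in> ball 0 r \<and> \<zeta> (\<phi> z) = z"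
    and z: "z \<in> S" and M: "\<And>n. cmod ((f ^^ n) z) \<le> M"
  shows "cmod ((deriv ^^ k) \<zeta> 0 / fact k) * cmod (\<phi> z) ^ k \<le> M"
proof -
  define d where "d = inverse (l ^ k)"
  have l0: "l \<noteq> 0" using norm_l by auto
  have d: "cmod d = 1" "d * l ^ k = 1" using norm_l l0 by (auto simp: d_def norm_inverse norm_power)
  define A where "A = (\<lambda>n z. (\<Sum>j<Suc n. d ^ j * (f ^^ j) z) / of_nat (Suc n))"
  have AB: "cmod (A n z) \<le> B" if B: "\<And>n. cmod ((f ^^ n) z) \<le> B" for n z B
  proof -
    have "cmod (\<Sum>j<Suc n. d ^ j * (f ^^ j) z) \<le> (\<Sum>j<Suc n. B)"
      by (rule sum_norm_le) (use B in \<open>simp add: norm_mult norm_power d\<close>)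
    thus ?thesis
      by (simp add: A_def norm_divide divide_le_eq mult.commute del: of_nat_Suc sum.lessThan_Suc)
  qed
  have holA: "A n holomorphic_on S" for n
    unfolding A_def by (intro holomorphic_intros hol_iter) auto
  obtain G s where G: "G holomorphic_on S" "strict_mono (s :: nat \<Rightarrow> nat)"
      "\<And>y. y \<in> S \<Longrightarrow> (\<lambda>i. A (s i) y) \<longlonglongrightarrow> G y"
      "\<And>K. compact K \<Longrightarrow> K \<subseteq> S \<Longrightarrow> uniform_limit K (A \<circ> s) G sequentially"
  proof (rule Montel[OF openS, of "range A" A])
    show "\<exists>B. \<forall>h\<in>range A. \<forall>z\<in>K. cmod (h z) \<le> B" if K: "compact K" "K \<subseteq> S" for K
    proof -
      obtain B where "\<And>n z. z \<in> K \<Longrightarrow> cmod ((f ^^ n) z) \<le> B" using compact_bounded[OF K] by auto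
      thus ?thesis using AB by blast
    qed
  qed (use holA in auto)
  have GM: "cmod (G z) \<le> M"
    by (rule LIMSEQ_le_const2[OF tendsto_norm[OF G(3)[OF z]]]) (use AB[OF M] in auto)
  have ball: "l ^ j * w \<in> ball 0 t" if "w \<in> ball 0 t" for j w t
    using that by (simp add: norm_mult norm_power norm_l)
  have iter\<zeta>: "(f ^^ j) (\<zeta> w) = \<zeta> (l ^ j * w)" if w: "w \<in> ball 0 r" for j w
    by (induction j) (use conj[OF ball[OF w]] in \<open>auto simp: mult.assoc\<close>)
  define C where "C = (\<lambda>n w. inverse (of_nat (Suc n)) * (\<Sum>j<Suc n. d ^ j * \<zeta> (l ^ j * w)))"
  have AC: "A n (\<zeta> w) = C n w" if "w \<in> ball 0 r" for n w
    using iter\<zeta>[OF that] by (simp add: A_def C_def divide_inverse mult.commute del: of_nat_Suc sum.lessThan_Suc)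
  have hol_rot: "(\<lambda>w. \<zeta> (l ^ j * w)) holomorphic_on ball 0 r" for j
  proof -
    have "(\<zeta> \<circ> (\<lambda>w. l ^ j * w)) holomorphic_on ball 0 r"
      by (rule holomorphic_on_compose[OF _ holomorphic_on_subset[OF hol\<zeta>]])
         (use ball in \<open>auto intro!: holomorphic_intros\<close>)
    thus ?thesis by (simp add: o_def)
  qed
  have hol_sum: "(\<lambda>w. \<Sum>j<m. d ^ j * \<zeta> (l ^ j * w)) holomorphic_on ball 0 r" for m
    by (intro holomorphic_intros hol_rot)
  have holC: "C n holomorphic_on ball 0 r" for n
    unfolding C_def by (intro holomorphic_intros hol_rot)
  define \<Gamma> where "\<Gamma> = (\<lambda>w. G (\<zeta> w))"
  have hol\<Gamma>: "\<Gamma> holomorphic_on ball 0 r"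
  proof -
    have "(G \<circ> \<zeta>) holomorphic_on ball 0 r"
      by (rule holomorphic_on_compose[OF hol\<zeta> holomorphic_on_subset[OF G(1)]]) (use \<zeta>S in auto)
    thus ?thesis by (simp add: \<Gamma>_def o_def)
  qed
  have cb: "cball 0 (r/2) \<subseteq> ball (0::complex) r" using r by auto
  have ul: "uniform_limit (ball 0 (r/2)) (\<lambda>n. C (s n)) \<Gamma> sequentially"
  proof (rule uniform_limitI)
    fix e :: real assume e: "e > 0"
    have "compact (\<zeta> ` cball 0 (r/2))"
      by (intro compact_continuous_image holomorphic_on_imp_continuous_on holomorphic_on_subset[OF hol\<zeta> cb]) auto
    hence "\<forall>\<^sub>F n in sequentially. \<forall>y\<in>\<zeta> ` cball 0 (r/2). dist ((A \<circ> s) n y) (G y) < e"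
      using cb \<zeta>S e by (intro uniform_limitD G(4)) auto
    thus "\<forall>\<^sub>F n in sequentially. \<forall>w\<in>ball 0 (r/2). dist (C (s n) w) (\<Gamma> w) < e"
    proof eventually_elim
      case (elim n)
      show ?case
      proof
        fix w :: complex assume w: "w \<in> ball 0 (r/2)"
        hence wr: "w \<in> ball 0 r" "\<zeta> w \<in> \<zeta> ` cball 0 (r/2)" using r by auto
        have "dist ((A \<circ> s) n (\<zeta> w)) (G (\<zeta> w)) < e" using elim wr(2) by blast
        thus "dist (C (s n) w) (\<Gamma> w) < e" by (simp add: \<Gamma>_def AC[OF wr(1)])
      qed
    qed
  qed
  have lim: "(\<lambda>n. (deriv ^^ i) (C (s n)) 0) \<longlonglongrightarrow> (deriv ^^ i) \<Gamma> 0" for i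
    by (rule higher_deriv_complex_uniform_limit[OF ul])
       (use r in \<open>auto intro!: always_eventually holomorphic_on_subset[OF holC]\<close>)
  have dC: "(deriv ^^ i) (C n) 0 = inverse (of_nat (Suc n)) * ((\<Sum>j<Suc n. (d * l ^ i) ^ j) * (deriv ^^ i) \<zeta> 0)" for i n
  proof -
    have "(deriv ^^ i) (C n) 0 = inverse (of_nat (Suc n)) * (deriv ^^ i) (\<lambda>w. \<Sum>j<Suc n. d ^ j * \<zeta> (l ^ j * w)) 0"
      unfolding C_def by (rule higher_deriv_cmult[OF hol_sum]) (use r in auto)
    thus ?thesis unfolding higher_deriv_rotation_sum[OF hol\<zeta> r norm_l] .
  qed
  have \<Gamma>k: "(deriv ^^ k) \<Gamma> 0 = (deriv ^^ k) \<zeta> 0"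
  proof (rule LIMSEQ_unique[OF lim])
    have "(deriv ^^ k) (C n) 0 = (deriv ^^ k) \<zeta> 0" for n
      unfolding dC d(2) by (simp del: of_nat_Suc)
    thus "(\<lambda>n. (deriv ^^ k) (C (s n)) 0) \<longlonglongrightarrow> (deriv ^^ k) \<zeta> 0" by simp
  qed
  have \<Gamma>0: "(deriv ^^ i) \<Gamma> 0 = 0" if i: "i \<noteq> k" for i
  proof (rule LIMSEQ_unique[OF lim])
    define q where "q = d * l ^ i"
    have q1: "q \<noteq> 1"
    proof
      assume "q = 1"
      hence "l ^ i = l ^ k" using l0 by (simp add: q_def d_def field_simps)
      thus False using l_power_inj i by blast
    qed
    have qn: "cmod q = 1" by (simp add: q_def norm_mult d norm_power norm_l)
    define B where "B = 2 / cmod (q - 1) * cmod ((deriv ^^ i) \<zeta> 0)"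
    have "cmod ((deriv ^^ i) (C n) 0) \<le> inverse (real (Suc n)) * B" for n
    proof -
      have "(\<Sum>j<Suc n. q ^ j) = (q ^ Suc n - 1) / (q - 1)" using q1 by (rule geometric_sum)
      also have "cmod \<dots> \<le> 2 / cmod (q - 1)"
        unfolding norm_divide
        using norm_triangle_ineq4[of "q ^ Suc n" 1] qn
        by (intro divide_right_mono) (auto simp: norm_power norm_mult)
      finally have "cmod ((\<Sum>j<Suc n. q ^ j) * (deriv ^^ i) \<zeta> 0) \<le> B"
        unfolding B_def norm_mult by (rule mult_right_mono) simp
      thus ?thesis unfolding dC q_def[symmetric] norm_mult[of "inverse _"]
        by (simp add: norm_inverse mult_left_mono del: of_nat_Suc sum.lessThan_Suc)
    qed
    hence "\<forall>n. cmod ((deriv ^^ i) (C (s n)) 0) \<le> inverse (real (Suc (s n))) * B" by blast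
    moreover have "(\<lambda>n. inverse (real (Suc (s n))) * B) \<longlonglongrightarrow> 0 * B"
      using LIMSEQ_subseq_LIMSEQ[OF LIMSEQ_inverse_real_of_nat G(2)]
      by (intro tendsto_intros) (simp add: o_def)
    hence lim0: "(\<lambda>n. inverse (real (Suc (s n))) * B) \<longlonglongrightarrow> 0" by simp
    ultimately show "(\<lambda>n. (deriv ^^ i) (C (s n)) 0) \<longlonglongrightarrow> 0"
      by (intro Lim_null_comparison[OF always_eventually lim0])
  qed
  define b where "b = (deriv ^^ k) \<zeta> 0 / fact k"
  have \<Gamma>: "\<Gamma> w = b * w ^ k" if w: "w \<in> ball 0 r" for w
  proof -
    have "(\<lambda>i. (deriv ^^ i) \<Gamma> 0 / fact i * (w - 0) ^ i) sums \<Gamma> w"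
      by (rule holomorphic_power_series[OF hol\<Gamma> w])
    also have "(\<lambda>i. (deriv ^^ i) \<Gamma> 0 / fact i * (w - 0) ^ i) = (\<lambda>i. if i = k then b * w ^ i else 0)"
      using \<Gamma>0 \<Gamma>k by (auto simp: b_def)
    finally show ?thesis using sums_single[of k "\<lambda>i. b * w ^ i"] sums_unique2 by blast
  qed
  have "G z = b * \<phi> z ^ k"
  proof (rule analytic_continuation_open[of W S G "\<lambda>z. b * \<phi> z ^ k"])
    show "G y = b * \<phi> y ^ k" if "y \<in> W" for y
      using \<Gamma>[of "\<phi> y"] W(4)[OF that] by (simp add: \<Gamma>_def)
  qed (use W openS connS G(1) z hol_\<phi> in \<open>auto intro!: holomorphic_intros\<close>)
  thus ?thesis using GM by (simp add: b_def norm_mult norm_power norm_divide)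
qed

text \<open>
  The disc about \<open>0\<close> of radius \<open>sup \<bar>\<phi>\<bar>\<close> over \<open>S\<close>, written so that an infinite supremum gives the plane.
\<close>

definition \<Omega> :: "complex set" where "\<Omega> = {w. \<exists>z\<in>S. cmod w < cmod (\<phi> z)}"

lemma open_\<phi>S: "open (\<phi> ` S)"
  by (rule open_mapping_thm[OF hol_\<phi> openS connS openS order_refl \<phi>_nonconstant])

lemma open_\<Omega>: "open \<Omega>"
proof -
  have "\<Omega> = (\<Union>z\<in>S. ball 0 (cmod (\<phi> z)))" by (auto simp: \<Omega>_def)
  thus ?thesis by auto
qed

lemma \<phi>_\<Omega>: "z \<in> S \<Longrightarrow> \<phi> z \<in> \<Omega>"
  using open_larger_norm[OF open_\<phi>S, of "\<phi> z"] by (auto simp: \<Omega>_def)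

text \<open>
  By the intermediate value theorem \<open>\<bar>\<phi>\<bar>\<close> takes every value below its supremum, and with a point \<open>\<phi> z\<close> the
  image contains the whole circle through it: the closure of the orbit of \<open>z\<close> is a compact subset of \<open>S\<close> whose
  image contains the points \<open>l\<^sup>j \<phi>(z)\<close>, which are dense in that circle.
\<close>

lemma \<phi>_surj: "\<phi> ` S = \<Omega>"
proof
  show "\<Omega> \<subseteq> \<phi> ` S"
  proof
    fix w assume "w \<in> \<Omega>"
    then obtain z1 where z1: "z1 \<in> S" "cmod w < cmod (\<phi> z1)" by (auto simp: \<Omega>_def)
    have "connected ((\<lambda>z. cmod (\<phi> z)) ` S)"
      by (intro connected_continuous_image connS continuous_intros holomorphic_on_imp_continuous_on hol_\<phi>)
    moreover have "cmod (\<phi> z0) \<in> (\<lambda>z. cmod (\<phi> z)) ` S" "cmod (\<phi> z1) \<in> (\<lambda>z. cmod (\<phi> z)) ` S"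
      using z0S z1 by auto
    ultimately have "{cmod (\<phi> z0)..cmod (\<phi> z1)} \<subseteq> (\<lambda>z. cmod (\<phi> z)) ` S"
      by (rule connected_contains_Icc)
    moreover have "cmod w \<in> {cmod (\<phi> z0)..cmod (\<phi> z1)}" using z1 \<phi>_z0 by auto
    ultimately obtain z where z: "z \<in> S" "cmod (\<phi> z) = cmod w" by auto
    show "w \<in> \<phi> ` S"
    proof (cases "w = 0")
      case True
      thus ?thesis using \<phi>_z0 z0S by force
    next
      case False
      obtain L where L': "compact L" "L \<subseteq> S" "\<And>y n. y \<in> {z} \<Longrightarrow> (f ^^ n) y \<in> L"
        by (rule orbit_closure_compact[of "{z}"]) (use z in auto)
      note L = L'(1,2) L'(3)[OF singletonI]
      have "compact (\<phi> ` L)"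
        by (intro compact_continuous_image holomorphic_on_imp_continuous_on holomorphic_on_subset[OF hol_\<phi>] L)
      hence cl: "closed (\<phi> ` L)" by (rule compact_imp_closed)
      have \<phi>z: "\<phi> z \<noteq> 0" using z False by auto
      have "\<exists>y\<in>\<phi> ` L. dist y w < e" if e: "e > 0" for e
      proof -
        have "cmod (w / \<phi> z) = 1" using z False by (simp add: norm_divide)
        then obtain j where j: "cmod (l ^ j - w / \<phi> z) < e / cmod w"
          using irrational_rotation_dense[OF norm_l l_power_ne_1] e False
          by (metis zero_less_divide_iff zero_less_norm_iff)
        have "l ^ j * \<phi> z - w = (l ^ j - w / \<phi> z) * \<phi> z" using \<phi>z by (simp add: field_simps)
        hence "cmod (l ^ j * \<phi> z - w) = cmod (l ^ j - w / \<phi> z) * cmod w" by (simp add: norm_mult z(2))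
        also have "\<dots> < e" using j False by (simp add: pos_less_divide_eq)
        finally have "dist (\<phi> ((f ^^ j) z)) w < e" by (simp add: dist_norm schroeder_iter z)
        thus ?thesis using L(3)[of j] by blast
      qed
      hence "w \<in> closure (\<phi> ` L)" by (simp add: closure_approachable)
      thus ?thesis using cl L(2) by auto
    qed
  qed
qed (use \<phi>_\<Omega> in auto)

text \<open>
  By \<open>Cesaro_coefficient_bound\<close> and Abel's lemma the power series of the local inverse converges on \<open>\<Omega>\<close>,
  and it inverts \<open>\<phi>\<close> on the connected set \<open>S\<close> because it does so near \<open>z0\<close>.
\<close>

lemma global_inverse:
  obtains \<zeta> where "\<zeta> holomorphic_on \<Omega>" "\<And>z. z \<in> S \<Longrightarrow> \<zeta> (\<phi> z) = z"
proof -
  obtain r \<zeta>0 W where r: "r > 0" and hol\<zeta>: "\<zeta>0 holomorphic_on ball 0 r" and \<zeta>S: "\<And>w. w \<in> ball 0 r \<Longrightarrow> \<zeta>0 w \<in> S"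
    and conj: "\<And>w. w \<in> ball 0 r \<Longrightarrow> f (\<zeta>0 w) = \<zeta>0 (l * w)"
    and W: "open W" "z0 \<in> W" "W \<subseteq> S" "\<And>z. z \<in> W \<Longrightarrow> \<phi> z \<in> ball 0 r \<and> \<zeta>0 (\<phi> z) = z"
    using local_inverse by metis
  define b where "b = (\<lambda>k. (deriv ^^ k) \<zeta>0 0 / fact k)"
  define \<zeta> where "\<zeta> = (\<lambda>w. \<Sum>k. b k * w ^ k)"
  have sums: "(\<lambda>k. b k * (w - 0) ^ k) sums \<zeta> w" if "z \<in> S" "cmod w < cmod (\<phi> z)" for z w
  proof -
    obtain M where M: "\<And>n. cmod ((f ^^ n) z) \<le> M" using compact_bounded[of "{z}"] \<open>z \<in> S\<close> by auto
    have "cmod (b k) * cmod (\<phi> z) ^ k \<le> M" for k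
      unfolding b_def by (rule Cesaro_coefficient_bound[OF r hol\<zeta> \<zeta>S conj W \<open>z \<in> S\<close> M])
    hence "summable (\<lambda>k. cmod (b k) * cmod w ^ k)"
      by (intro Abel_lemma[of _ "cmod (\<phi> z)"]) (use that in auto)
    hence "summable (\<lambda>k. cmod (b k * w ^ k))" by (simp add: norm_mult norm_power)
    hence "summable (\<lambda>k. b k * w ^ k)" by (rule summable_norm_cancel)
    thus ?thesis by (simp add: \<zeta>_def summable_sums)
  qed
  have hol: "\<zeta> holomorphic_on \<Omega>"
    unfolding holomorphic_on_def
  proof
    fix w assume "w \<in> \<Omega>"
    then obtain z where z: "z \<in> S" "cmod w < cmod (\<phi> z)" by (auto simp: \<Omega>_def)
    have "\<zeta> holomorphic_on ball 0 (cmod (\<phi> z))"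
      by (rule power_series_holomorphic[where a = b]) (use sums[OF z(1)] in auto)
    hence "\<zeta> field_differentiable at w"
      by (rule holomorphic_on_imp_differentiable_at) (use z in auto)
    thus "\<zeta> field_differentiable at w within \<Omega>" by (rule field_differentiable_at_within)
  qed
  have local: "\<zeta> w = \<zeta>0 w" if w: "w \<in> ball 0 r" for w
  proof -
    have "(\<lambda>k. b k * (w - 0) ^ k) sums \<zeta>0 w"
      unfolding b_def by (rule holomorphic_power_series[OF hol\<zeta> w])
    thus ?thesis by (simp add: \<zeta>_def sums_iff)
  qed
  have "(\<zeta> \<circ> \<phi>) holomorphic_on S"
    by (rule holomorphic_on_compose[OF hol_\<phi> holomorphic_on_subset[OF hol]]) (use \<phi>_\<Omega> in auto)
  hence hol': "(\<lambda>z. \<zeta> (\<phi> z)) holomorphic_on S" by (simp add: o_def)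
  have "\<zeta> (\<phi> z) = z" if z: "z \<in> S" for z
  proof (rule analytic_continuation_open[of W S "\<lambda>z. \<zeta> (\<phi> z)" "\<lambda>z. z"])
    show "\<zeta> (\<phi> y) = y" if "y \<in> W" for y
      using local[of "\<phi> y"] W(4)[OF that] by simp
  qed (use W openS connS z hol' in auto)
  with hol show ?thesis using that by blast
qed

lemma compact_in_disc:
  assumes K: "compact K" "K \<subseteq> S"
  obtains \<rho> r where "0 < \<rho>" "\<rho> < r" "\<phi> ` K \<subseteq> cball 0 \<rho>" "cball 0 r \<subseteq> \<Omega>"
proof -
  define K' where "K' = insert z0 K"
  have K': "compact K'" "K' \<subseteq> S" "K' \<noteq> {}" using K z0S by (auto simp: K'_def)
  have "continuous_on K' (\<lambda>z. cmod (\<phi> z))"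
    by (intro continuous_intros holomorphic_on_imp_continuous_on holomorphic_on_subset[OF hol_\<phi>] K')
  then obtain z where z: "z \<in> K'" "\<And>y. y \<in> K' \<Longrightarrow> cmod (\<phi> y) \<le> cmod (\<phi> z)"
    using continuous_attains_sup[OF K'(1,3)] by blast
  obtain z1 where z1: "z1 \<in> S" "cmod (\<phi> z) < cmod (\<phi> z1)"
    using open_larger_norm[OF open_\<phi>S, of "\<phi> z"] z K' by auto
  define R where "R = cmod (\<phi> z1)" define m where "m = cmod (\<phi> z)"
  have m: "0 \<le> m" "m < R" using z1 by (auto simp: m_def R_def)
  show ?thesis
  proof (rule that[of "(2 * m + R) / 3" "(m + 2 * R) / 3"])
    show "\<phi> ` K \<subseteq> cball 0 ((2 * m + R) / 3)"
    proof
      fix w assume "w \<in> \<phi> ` K"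
      hence "cmod w \<le> m" using z(2) by (auto simp: K'_def m_def)
      thus "w \<in> cball 0 ((2 * m + R) / 3)" using m by (simp add: field_simps)
    qed
    show "cball 0 ((m + 2 * R) / 3) \<subseteq> \<Omega>"
    proof
      fix w :: complex assume "w \<in> cball 0 ((m + 2 * R) / 3)"
      hence "cmod w < R" using m by (simp add: field_simps)
      thus "w \<in> \<Omega>" using z1 by (auto simp: \<Omega>_def R_def)
    qed
  qed (use m in auto)
qed

end

section \<open>Convergence of the Koenigs functions\<close>

text \<open>
  With \<open>v = 1 - \<mu> / l\<close> the angle condition says \<open>Re v \<ge> \<bar>v\<bar> cos \<Theta>\<close>, so that
  \<open>\<bar>\<mu>\<bar>\<^sup>2 = 1 - 2 Re v + \<bar>v\<bar>\<^sup>2\<close> falls below \<open>1\<close> linearly in \<open>\<bar>v\<bar> = \<bar>\<mu> - l\<bar>\<close>.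
\<close>

lemma stolz_angle_contraction:
  fixes \<mu> l :: complex
  assumes l: "cmod l = 1" and \<Theta>: "\<Theta> < pi / 2" and arg: "\<bar>Arg (1 - \<mu> / l)\<bar> < \<Theta>"
    and small: "cmod (\<mu> - l) \<le> cos \<Theta>"
  shows "cmod \<mu> \<le> 1 - cos \<Theta> / 2 * cmod (\<mu> - l)"
proof -
  define v where "v = 1 - \<mu> / l"
  define e where "e = cmod (\<mu> - l)"
  define c where "c = cos \<Theta>"
  have l0: "l \<noteq> 0" using l by auto
  have "v = - ((\<mu> - l) / l)" using l0 by (simp add: v_def field_simps)
  hence ve: "cmod v = e" using l by (simp add: e_def norm_divide)
  have c1: "c \<le> 1" by (simp add: c_def)
  have e: "0 \<le> e" "e \<le> c" using small by (auto simp: e_def c_def)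
  have "v = rcis e (Arg v)" using rcis_cmod_Arg[of v] by (simp add: ve)
  hence "Re v = e * cos (Arg v)" by (metis Re_rcis)
  also have "cos (Arg v) = cos \<bar>Arg v\<bar>" by simp
  also have "e * cos \<bar>Arg v\<bar> \<ge> e * c"
    unfolding c_def using e(1) arg \<Theta> by (intro mult_left_mono cos_monotone_0_pi_le) (auto simp: v_def)
  finally have Re: "Re v \<ge> e * c" .
  have "\<mu> = l * (1 - v)" using l0 by (simp add: v_def)
  hence "(cmod \<mu>)\<^sup>2 = (cmod (1 - v))\<^sup>2" using l by (simp add: norm_mult)
  also have "\<dots> = 1 - 2 * Re v + (cmod v)\<^sup>2"
    by (simp add: cmod_power2 power2_diff)
  also have "\<dots> \<le> 1 - 2 * (e * c) + e * e"
    using Re by (simp add: ve power2_eq_square)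
  also have "\<dots> \<le> 1 - e * c"
    using mult_left_mono[OF e(2,1)] by (simp add: mult.commute)
  also have "\<dots> \<le> (1 - c / 2 * e)\<^sup>2"
    by (simp add: power2_diff mult_ac)
  finally have sq: "(cmod \<mu>)\<^sup>2 \<le> (1 - c / 2 * e)\<^sup>2" .
  have "c / 2 * e \<le> 1 * 1" using c1 e by (intro mult_mono) auto
  hence "cmod \<mu> \<le> 1 - c / 2 * e" by (intro power2_le_imp_le[OF sq]) simp
  thus ?thesis by (simp add: e_def c_def)
qed

lemma subset_immediate_basin:
  assumes hol: "F holomorphic_on U" and W: "open W" "connected W" "z0 \<in> W"
    and L: "bounded L" "L \<subseteq> U" and inv: "\<And>n z. z \<in> W \<Longrightarrow> (F ^^ n) z \<in> L"
  shows "W \<subseteq> immediate_basin z0 F U"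
proof -
  have esc: "W \<subseteq> escape_free F U"
    using inv L(2) unfolding escape_free_iff subset_iff by blast
  obtain B where B: "\<And>z. z \<in> L \<Longrightarrow> cmod z \<le> B" using L(1) by (auto simp: bounded_iff)
  have "normal_family_on ((\<lambda>n. F ^^ n) ` {1..}) W"
    by (rule bounded_imp_normal_family[OF W(1), of _ B])
       (use iterates_holomorphic[OF hol esc] inv B in auto)
  hence "W \<subseteq> fatou_set F U"
    using W(1) esc interior_maximal[OF esc W(1)] by (auto simp: fatou_set_def)
  thus ?thesis
    unfolding immediate_basin_def by (intro connected_component_maximal W)
qed

context siegel_linearization
begin

text \<open>
  Choose radii \<open>\<rho> < r\<close> such that \<open>\<phi>(K)\<close> lies in the disc of radius \<open>\<rho>\<close> and the closed disc of radius
  \<open>r\<close> is contained in \<open>\<Omega>\<close>; the set \<open>D\<close> is the image of the latter under \<open>\<zeta> = \<phi>\<^sup>-\<^sup>1\<close>. If \<open>F\<close> is close to \<open>f\<close> on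
  \<open>D\<close>, then \<open>g = \<phi> \<circ> F \<circ> \<zeta>\<close> is defined on the disc of radius \<open>r\<close> and is a perturbed rotation, the bound on
  \<open>F - f\<close> being carried over by a Lipschitz constant of \<open>\<phi>\<close>. The result on perturbed rotations
  is used twice. For radius \<open>\<rho> + 3 h\<close> it confines orbits, so that \<open>W\<close> is part of the basin of
  \<open>F\<close> and \<open>k = \<psi> \<circ> \<zeta>\<close> is holomorphic on the disc of radius \<open>\<rho> + 3 h\<close>. For the smaller radius \<open>\<rho>\<close> it
  compares \<open>k\<close> with the identity; this needs the Schroeder equation for \<open>k\<close>, known near \<open>0\<close>, on the disc
  of radius \<open>\<rho> + h\<close>, and the gap between the radii leaves room for its analytic continuation.
\<close>

lemma nearby_koenigs:
  assumes K: "compact K" "K \<subseteq> S" and c: "c > 0" and \<delta>: "\<delta> > 0"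
  obtains D where "compact D" "D \<subseteq> U"
    "\<forall>M. \<exists>\<eta>>0. \<forall>F \<psi>. F holomorphic_on U \<longrightarrow> F z0 = z0 \<longrightarrow> deriv F z0 \<noteq> l \<longrightarrow>
        cmod (deriv F z0 - l) < \<eta> \<longrightarrow> cmod (deriv F z0) \<le> 1 - c * cmod (deriv F z0 - l) \<longrightarrow>
        (\<forall>z\<in>D. cmod (F z - f z) \<le> M * cmod (deriv F z0 - l)) \<longrightarrow>
        is_koenigs_function F U z0 \<psi> \<longrightarrow>
        K \<subseteq> immediate_basin z0 F U \<and> (\<forall>z\<in>K. cmod (\<psi> z - \<phi> z) \<le> \<delta>)"
proof -
  obtain \<zeta> where hol\<zeta>: "\<zeta> holomorphic_on \<Omega>" and \<zeta>\<phi>: "\<And>z. z \<in> S \<Longrightarrow> \<zeta> (\<phi> z) = z"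
    using global_inverse by blast
  have \<zeta>S: "\<zeta> w \<in> S" and \<phi>\<zeta>: "\<phi> (\<zeta> w) = w" if "w \<in> \<Omega>" for w
    using that \<zeta>\<phi> unfolding \<phi>_surj[symmetric] by auto
  obtain \<rho> r where \<rho>: "0 < \<rho>" "\<rho> < r" "\<phi> ` K \<subseteq> cball 0 \<rho>" and r\<Omega>: "cball 0 r \<subseteq> \<Omega>"
    using compact_in_disc[OF K] by blast
  have br\<Omega>: "w \<in> \<Omega>" if "cmod w \<le> r" for w using r\<Omega> that by auto
  \<comment> \<open>Orbits from radius \<open>\<rho>\<close> stay in radius \<open>\<rho> + h\<close>, the Schroeder equation is continued to radius \<open>\<rho> + 2 h\<close>, and orbits from radius \<open>\<rho> + 3 h\<close> stay in radius \<open>\<rho> + 4 h < r\<close>.\<close>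
  define h where "h = (r - \<rho>) / 5"
  have h: "h > 0" "r = \<rho> + 5 * h" using \<rho> unfolding h_def by argo+
  define D where "D = \<zeta> ` cball 0 r"
  have D: "compact D" "D \<subseteq> S"
    unfolding D_def using \<zeta>S r\<Omega>
    by (auto intro!: compact_continuous_image holomorphic_on_imp_continuous_on holomorphic_on_subset[OF hol\<zeta> r\<Omega>])
  have fD: "compact (f ` D)" "f ` D \<subseteq> S"
    using D f_S S_U by (auto intro!: compact_continuous_image holomorphic_on_imp_continuous_on holomorphic_on_subset[OF holf])
  obtain d where d: "d > 0" "(\<Union>x\<in>f ` D. cball x d) \<subseteq> S"
    using compact_subset_open_imp_cball_epsilon_subset[OF fD(1) openS fD(2)] by blast
  define N where "N = {x + y |x y. x \<in> f ` D \<and> y \<in> cball 0 d}"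
  have N: "compact N" unfolding N_def by (intro compact_sums fD) auto
  have Nball: "cball x d \<subseteq> N" if "x \<in> f ` D" for x
  proof
    fix u assume "u \<in> cball x d"
    thus "u \<in> N" unfolding N_def using that
      by (intro CollectI exI[of _ x] exI[of _ "u - x"]) (auto simp: dist_norm norm_minus_commute)
  qed
  have NS: "N \<subseteq> S"
  proof
    fix u assume "u \<in> N"
    then obtain x y where "x \<in> f ` D" "y \<in> cball 0 d" "u = x + y" by (auto simp: N_def)
    hence "u \<in> (\<Union>x\<in>f ` D. cball x d)" by (intro UN_I[of x]) (auto simp: dist_norm)
    thus "u \<in> S" using d(2) by blast
  qed
  have "continuous_on N (deriv \<phi>)"
    by (intro holomorphic_on_imp_continuous_on holomorphic_on_subset[OF holomorphic_deriv[OF hol_\<phi> openS]] NS)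
  hence "bounded (deriv \<phi> ` N)" using N compact_continuous_image compact_imp_bounded by blast
  then obtain C where C: "C > 0" "\<And>u. u \<in> N \<Longrightarrow> cmod (deriv \<phi> u) \<le> C"
    by (auto simp: bounded_pos)
  have Lip: "cmod (\<phi> u - \<phi> x) \<le> C * cmod (u - x)" if x: "x \<in> f ` D" and u: "u \<in> cball x d" for u x
  proof (rule field_differentiable_bound[of "cball x d"])
    show "(\<phi> has_field_derivative deriv \<phi> y) (at y within cball x d)" if "y \<in> cball x d" for y
      using holomorphic_derivI[OF hol_\<phi> openS] Nball[OF x] NS that by blast
    show "cmod (deriv \<phi> y) \<le> C" if "y \<in> cball x d" for y
      using C(2) Nball[OF x] that by blast
  qed (use u d in auto)
  have d\<phi>: "(\<phi> has_field_derivative 1) (at z0)"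
    using holomorphic_derivI[OF hol_\<phi> openS z0S] deriv_\<phi> by simp
  have \<zeta>0: "\<zeta> 0 = z0" using \<zeta>\<phi>[OF z0S] \<phi>_z0 by simp
  have zero\<Omega>: "0 \<in> \<Omega>" using br\<Omega>[of 0] \<rho> by simp
  have d\<zeta>: "(\<zeta> has_field_derivative 1) (at 0)"
  proof -
    have 1: "(\<zeta> has_field_derivative deriv \<zeta> 0) (at 0)"
      by (rule holomorphic_derivI[OF hol\<zeta> open_\<Omega> zero\<Omega>])
    have "((\<zeta> \<circ> \<phi>) has_field_derivative deriv \<zeta> 0 * 1) (at z0)"
      by (rule DERIV_chain[OF _ d\<phi>]) (use 1 \<phi>_z0 in simp)
    moreover have "((\<zeta> \<circ> \<phi>) has_field_derivative deriv \<zeta> 0 * 1) (at z0) = ((\<lambda>z. z) has_field_derivative deriv \<zeta> 0 * 1) (at z0)"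
      by (rule DERIV_cong_ev) (use eventually_nhds_in_open[OF openS z0S] \<zeta>\<phi> in \<open>auto elim: eventually_mono\<close>)
    ultimately have "((\<lambda>z. z) has_field_derivative deriv \<zeta> 0 * 1) (at z0)" by blast
    from DERIV_unique[OF this DERIV_ident] have "deriv \<zeta> 0 = 1" by simp
    thus ?thesis using 1 by simp
  qed
  have main: "\<exists>\<eta>>0. \<forall>F \<psi>. F holomorphic_on U \<longrightarrow> F z0 = z0 \<longrightarrow> deriv F z0 \<noteq> l \<longrightarrow>
        cmod (deriv F z0 - l) < \<eta> \<longrightarrow> cmod (deriv F z0) \<le> 1 - c * cmod (deriv F z0 - l) \<longrightarrow>
        (\<forall>z\<in>D. cmod (F z - f z) \<le> M0 * cmod (deriv F z0 - l)) \<longrightarrow>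
        is_koenigs_function F U z0 \<psi> \<longrightarrow>
        K \<subseteq> immediate_basin z0 F U \<and> (\<forall>z\<in>K. cmod (\<psi> z - \<phi> z) \<le> \<delta>)" for M0
  proof -
    define M where "M = \<bar>M0\<bar> + 1"
    have M: "M > 0" by (simp add: M_def)
    obtain e1 where e1: "e1 > 0" and pert1:
      "\<And>g \<mu>. g holomorphic_on ball 0 r \<Longrightarrow> g 0 = 0 \<Longrightarrow> deriv g 0 = \<mu> \<Longrightarrow> \<mu> \<noteq> l \<Longrightarrow>
       cmod (\<mu> - l) < e1 \<Longrightarrow> cmod \<mu> \<le> 1 - c * cmod (\<mu> - l) \<Longrightarrow>
       (\<And>w. w \<in> ball 0 r \<Longrightarrow> cmod (g w - l * w) \<le> (C * M) * cmod (\<mu> - l)) \<Longrightarrow>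
       (\<forall>w\<in>cball 0 (\<rho> + 3 * h). \<forall>j. (g ^^ j) w \<in> cball 0 (\<rho> + 4 * h)) \<and>
       (\<forall>k. (k has_field_derivative 1) (at 0) \<longrightarrow> (\<forall>w\<in>cball 0 (\<rho> + 4 * h). k (g w) = \<mu> * k w) \<longrightarrow>
          (\<forall>w\<in>cball 0 (\<rho> + 3 * h). cmod (k w - w) \<le> \<delta>))"
      by (rule perturbed_rotation[OF norm_l l_power_ne_1, of "\<rho> + 3 * h" "\<rho> + 4 * h" r "C * M" c \<delta>])
         (use \<rho> h M C c \<delta> in auto)
    obtain e2 where e2: "e2 > 0" and pert2:
      "\<And>g \<mu>. g holomorphic_on ball 0 r \<Longrightarrow> g 0 = 0 \<Longrightarrow> deriv g 0 = \<mu> \<Longrightarrow> \<mu> \<noteq> l \<Longrightarrow>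
       cmod (\<mu> - l) < e2 \<Longrightarrow> cmod \<mu> \<le> 1 - c * cmod (\<mu> - l) \<Longrightarrow>
       (\<And>w. w \<in> ball 0 r \<Longrightarrow> cmod (g w - l * w) \<le> (C * M) * cmod (\<mu> - l)) \<Longrightarrow>
       (\<forall>w\<in>cball 0 \<rho>. \<forall>j. (g ^^ j) w \<in> cball 0 (\<rho> + h)) \<and>
       (\<forall>k. (k has_field_derivative 1) (at 0) \<longrightarrow> (\<forall>w\<in>cball 0 (\<rho> + h). k (g w) = \<mu> * k w) \<longrightarrow>
          (\<forall>w\<in>cball 0 \<rho>. cmod (k w - w) \<le> \<delta>))"
      by (rule perturbed_rotation[OF norm_l l_power_ne_1, of "\<rho>" "\<rho> + h" r "C * M" c \<delta>])
         (use \<rho> h M C c \<delta> in auto)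
    define \<eta> where "\<eta> = min (min e1 e2) (min (d / M) (h / (C * M)))"
    have \<eta>: "\<eta> > 0" using e1 e2 d M h C by (simp add: \<eta>_def)
    show ?thesis
    proof (intro exI[of _ \<eta>] conjI[OF \<eta>] allI impI)
      fix F \<psi>
      assume holF: "F holomorphic_on U" and Fz0: "F z0 = z0" and ne: "deriv F z0 \<noteq> l"
        and small: "cmod (deriv F z0 - l) < \<eta>" and stolz: "cmod (deriv F z0) \<le> 1 - c * cmod (deriv F z0 - l)"
        and close: "\<forall>z\<in>D. cmod (F z - f z) \<le> M0 * cmod (deriv F z0 - l)"
        and koeF: "is_koenigs_function F U z0 \<psi>"
      define \<mu> where "\<mu> = deriv F z0"
      define e where "e = cmod (\<mu> - l)"
      have e: "e > 0" "e < e1" "e < e2" "e < d / M" "e < h / (C * M)"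
        using ne small by (auto simp: e_def \<mu>_def \<eta>_def)
      have Me: "M * e < d" "C * M * e < h"
        using e(4,5) M C by (simp_all add: pos_less_divide_eq mult.commute mult.left_commute)
      have closeM: "cmod (F z - f z) \<le> M * e" if "z \<in> D" for z
      proof -
        have "cmod (F z - f z) \<le> M0 * e" using close that by (simp add: e_def \<mu>_def)
        also have "\<dots> \<le> M * e" using e by (intro mult_right_mono) (auto simp: M_def)
        finally show ?thesis .
      qed
      have \<zeta>D: "\<zeta> w \<in> D" if "cmod w \<le> r" for w using that by (auto simp: D_def)
      have Fcb: "F (\<zeta> w) \<in> cball (f (\<zeta> w)) d" if "cmod w \<le> r" for w
        using closeM[OF \<zeta>D[OF that]] Me by (auto simp: dist_norm norm_minus_commute)
      have FS: "F (\<zeta> w) \<in> S" if "cmod w \<le> r" for w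
        using Fcb[OF that] Nball[of "f (\<zeta> w)"] NS \<zeta>D[OF that] by blast
      define g where "g = (\<lambda>w. \<phi> (F (\<zeta> w)))"
      have conj: "F (\<zeta> w) = \<zeta> (g w)" if "cmod w \<le> r" for w
        using \<zeta>\<phi>[OF FS[OF that]] by (simp add: g_def)
      have holg: "g holomorphic_on ball 0 r"
      proof -
        have 1: "\<zeta> holomorphic_on ball 0 r" using hol\<zeta> r\<Omega> by (meson ball_subset_cball holomorphic_on_subset order_trans)
        have 2: "(F \<circ> \<zeta>) holomorphic_on ball 0 r"
          by (rule holomorphic_on_compose[OF 1 holomorphic_on_subset[OF holF]])
             (use \<zeta>D D S_U in fastforce)
        have "(\<phi> \<circ> (F \<circ> \<zeta>)) holomorphic_on ball 0 r"
          by (rule holomorphic_on_compose[OF 2 holomorphic_on_subset[OF hol_\<phi>]]) (use FS in auto)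
        thus ?thesis by (simp add: g_def o_def)
      qed
      have g0: "g 0 = 0" by (simp add: g_def \<zeta>0 Fz0 \<phi>_z0)
      have dF: "(F has_field_derivative \<mu>) (at z0)"
        unfolding \<mu>_def by (rule holomorphic_derivI[OF holF openU z0U])
      have "((\<phi> \<circ> (F \<circ> \<zeta>)) has_field_derivative 1 * (\<mu> * 1)) (at 0)"
        by (intro DERIV_chain) (use d\<phi> dF d\<zeta> \<zeta>0 Fz0 in auto)
      hence dg: "deriv g 0 = \<mu>" by (simp add: g_def o_def DERIV_imp_deriv)
      have gB: "cmod (g w - l * w) \<le> (C * M) * cmod (\<mu> - l)" if w: "w \<in> ball 0 r" for w
      proof -
        have wr: "cmod w \<le> r" using w by simp
        have "l * w = \<phi> (f (\<zeta> w))" using schroeder[OF \<zeta>S] \<phi>\<zeta> br\<Omega>[OF wr] by simp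
        hence "cmod (g w - l * w) \<le> C * cmod (F (\<zeta> w) - f (\<zeta> w))"
          using Lip[OF _ Fcb[OF wr]] \<zeta>D[OF wr] by (simp add: g_def)
        also have "\<dots> \<le> C * (M * e)" using closeM[OF \<zeta>D[OF wr]] C by (intro mult_left_mono) auto
        finally show ?thesis by (simp add: e_def mult.assoc)
      qed
      have ne': "\<mu> \<noteq> l" and stolz': "cmod \<mu> \<le> 1 - c * cmod (\<mu> - l)" using ne stolz by (auto simp: \<mu>_def)
      have orbit: "(g ^^ j) w \<in> cball 0 (\<rho> + 4 * h)" if "w \<in> cball 0 (\<rho> + 3 * h)" for w j
        using pert1[OF holg g0 dg ne' _ stolz' gB] e that by (auto simp: e_def)
      have iter: "(F ^^ j) (\<zeta> w) = \<zeta> ((g ^^ j) w)" if w: "w \<in> cball 0 (\<rho> + 3 * h)" for w j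
      proof (induction j)
        case (Suc j)
        have "cmod ((g ^^ j) w) \<le> r" using orbit[OF w, of j] h by simp
        thus ?case using Suc conj by simp
      qed simp
      define W where "W = \<zeta> ` ball 0 (\<rho> + 3 * h)"
      have sub: "ball 0 (\<rho> + 3 * h) \<subseteq> \<Omega>" using h by (auto intro: br\<Omega>)
      have W\<phi>: "W = S \<inter> \<phi> -` ball 0 (\<rho> + 3 * h)"
      proof (intro equalityI subsetI)
        fix z assume "z \<in> W"
        then obtain w where w: "w \<in> ball 0 (\<rho> + 3 * h)" "z = \<zeta> w" by (auto simp: W_def)
        hence "w \<in> \<Omega>" using sub by blast
        thus "z \<in> S \<inter> \<phi> -` ball 0 (\<rho> + 3 * h)" using w \<zeta>S \<phi>\<zeta> by simp
      next
        fix z assume "z \<in> S \<inter> \<phi> -` ball 0 (\<rho> + 3 * h)"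
        hence "z = \<zeta> (\<phi> z)" "\<phi> z \<in> ball 0 (\<rho> + 3 * h)" using \<zeta>\<phi> by auto
        thus "z \<in> W" unfolding W_def by (rule image_eqI)
      qed
      have W: "open W" "connected W" "z0 \<in> W"
      proof -
        show "open W" unfolding W\<phi>
          by (intro continuous_open_preimage holomorphic_on_imp_continuous_on hol_\<phi> openS) auto
        show "connected W" unfolding W_def
          by (intro connected_continuous_image holomorphic_on_imp_continuous_on holomorphic_on_subset[OF hol\<zeta> sub]) auto
        show "z0 \<in> W" using z0S \<phi>_z0 \<rho> h by (simp add: W\<phi>)
      qed
      have basin: "W \<subseteq> immediate_basin z0 F U"
      proof (rule subset_immediate_basin[OF holF W, of D])
        show "bounded D" "D \<subseteq> U" using D S_U compact_imp_bounded by auto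
        fix n z assume "z \<in> W"
        then obtain w where "w \<in> ball 0 (\<rho> + 3 * h)" "z = \<zeta> w" by (auto simp: W_def)
        hence w: "w \<in> cball 0 (\<rho> + 3 * h)" "z = \<zeta> w" by simp_all
        have "cmod ((g ^^ n) w) \<le> r" using orbit[OF w(1), of n] h by simp
        thus "(F ^^ n) z \<in> D" using \<zeta>D by (simp add: w(2) iter[OF w(1)])
      qed
      have KW: "K \<subseteq> W"
      proof
        fix z assume "z \<in> K"
        hence "z \<in> S" "cmod (\<phi> z) \<le> \<rho>" using K \<rho> by auto
        thus "z \<in> W" using h by (simp add: W\<phi>)
      qed
      define k where "k = (\<lambda>w. \<psi> (\<zeta> w))"
      have hol\<psi>: "\<psi> holomorphic_on W"
        using koeF basin by (auto simp: is_koenigs_function_def intro: holomorphic_on_subset)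
      have holk: "k holomorphic_on ball 0 (\<rho> + 3 * h)"
      proof -
        have "(\<psi> \<circ> \<zeta>) holomorphic_on ball 0 (\<rho> + 3 * h)"
          by (rule holomorphic_on_compose[OF holomorphic_on_subset[OF hol\<zeta> sub] holomorphic_on_subset[OF hol\<psi>]])
             (simp add: W_def)
        thus ?thesis by (simp add: k_def o_def)
      qed
      have dk: "(k has_field_derivative 1) (at 0)"
      proof -
        have "(\<psi> has_field_derivative 1) (at z0)"
          using holomorphic_derivI[OF hol\<psi> W(1,3)] koeF by (simp add: is_koenigs_function_def)
        hence "((\<psi> \<circ> \<zeta>) has_field_derivative 1 * 1) (at 0)"
          by (intro DERIV_chain) (use d\<zeta> \<zeta>0 in auto)
        thus ?thesis by (simp add: k_def o_def)
      qed
      have gmaps: "g w \<in> ball 0 (\<rho> + 3 * h)" if w: "w \<in> ball 0 (\<rho> + 2 * h)" for w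
      proof -
        have "w \<in> ball 0 r" using w h by auto
        hence "cmod (g w - l * w) < h" using gB[of w] Me(2) by (simp add: e_def)
        moreover have "cmod (g w) \<le> cmod (l * w) + cmod (g w - l * w)" by (rule norm_triangle_sub)
        ultimately show ?thesis using w by (simp add: norm_mult norm_l)
      qed
      have kg: "k (g w) = \<mu> * k w" if w: "w \<in> ball 0 (\<rho> + 2 * h)" for w
      proof -
        have "\<forall>\<^sub>F z in nhds z0. \<psi> (F z) = \<mu> * \<psi> z"
          using koeF by (simp add: is_koenigs_function_def \<mu>_def)
        moreover have "filterlim \<zeta> (nhds z0) (nhds 0)"
          using isContD[OF DERIV_isCont[OF d\<zeta>], unfolded tendsto_at_iff_tendsto_nhds]
          unfolding \<zeta>0 .
        ultimately have "\<forall>\<^sub>F w in nhds 0. \<psi> (F (\<zeta> w)) = \<mu> * \<psi> (\<zeta> w)"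
          by (auto simp: filterlim_iff)
        then obtain T where T: "open T" "0 \<in> T" "\<And>w. w \<in> T \<Longrightarrow> \<psi> (F (\<zeta> w)) = \<mu> * \<psi> (\<zeta> w)"
          by (auto simp: eventually_nhds)
        have "(k \<circ> g) holomorphic_on ball 0 (\<rho> + 2 * h)"
          by (rule holomorphic_on_compose[OF holomorphic_on_subset[OF holg] holomorphic_on_subset[OF holk]])
             (use h gmaps in auto)
        hence holkg: "(\<lambda>w. k (g w)) holomorphic_on ball 0 (\<rho> + 2 * h)" by (simp add: o_def)
        show ?thesis
        proof (rule analytic_continuation_open[of "T \<inter> ball 0 (\<rho> + 2 * h)" "ball 0 (\<rho> + 2 * h)" "\<lambda>w. k (g w)" "\<lambda>w. \<mu> * k w"])
          show "(\<lambda>w. \<mu> * k w) holomorphic_on ball 0 (\<rho> + 2 * h)"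
            using h by (intro holomorphic_intros holomorphic_on_subset[OF holk]) auto
          show "T \<inter> ball 0 (\<rho> + 2 * h) \<noteq> {}" using T \<rho> h by (auto intro!: exI[of _ 0])
          show "k (g u) = \<mu> * k u" if "u \<in> T \<inter> ball 0 (\<rho> + 2 * h)" for u
          proof -
            have "cmod u \<le> r" using that h by simp
            thus ?thesis using T(3)[of u] that conj[of u] by (simp add: k_def)
          qed
        qed (use T w holkg in auto)
      qed
      have "cmod (k w - w) \<le> \<delta>" if w: "w \<in> cball 0 \<rho>" for w
      proof -
        have "\<forall>w\<in>cball 0 (\<rho> + h). k (g w) = \<mu> * k w" using kg h by auto
        thus ?thesis using pert2[OF holg g0 dg ne' _ stolz' gB] e dk w by (auto simp: e_def)
      qed
      hence "cmod (\<psi> z - \<phi> z) \<le> \<delta>" if "z \<in> K" for z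
        using that \<rho>(3) K \<zeta>\<phi>[of z] unfolding k_def by (metis image_subset_iff subset_iff)
      thus "K \<subseteq> immediate_basin z0 F U \<and> (\<forall>z\<in>K. cmod (\<psi> z - \<phi> z) \<le> \<delta>)"
        using KW basin by auto
    qed
  qed
  show ?thesis
  proof (rule that[of D])
    show "compact D" "D \<subseteq> U" using D S_U by auto
  qed (use main in blast)
qed

end

theorem theorem2:
  fixes U :: "complex set" and z0 :: complex
    and f \<phi> :: "nat \<Rightarrow> complex \<Rightarrow> complex" and \<Theta> :: real
  assumes "open U" and "connected U"
    and "f 0 holomorphic_on U" and "siegel_point (f 0) U z0"
    and "\<And>n. n \<ge> 1 \<Longrightarrow> f n holomorphic_on U"
    and "\<And>n. n \<ge> 1 \<Longrightarrow> attracting (f n) U z0"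
    and "\<And>K. compact K \<Longrightarrow> K \<subseteq> U \<Longrightarrow> uniform_limit K f (f 0) sequentially"
    and "\<Theta> < pi / 2"
    and "\<And>n. n \<ge> 1 \<Longrightarrow> \<bar>Arg (1 - deriv (f n) z0 / deriv (f 0) z0)\<bar> < \<Theta>"
    and "\<And>K. compact K \<Longrightarrow> K \<subseteq> U \<Longrightarrow>
           \<exists>M. \<forall>n\<ge>1. \<forall>z\<in>K.
             cmod ((f n z - f 0 z) / (deriv (f n) z0 - deriv (f 0) z0)) \<le> M"
    and "is_koenigs_function (f 0) U z0 (\<phi> 0)"
    and "\<And>n. n \<ge> 1 \<Longrightarrow> geometrically_attracting (f n) U z0 \<Longrightarrow>
           is_koenigs_function (f n) U z0 (\<phi> n)"
  shows "\<forall>K. compact K \<and> K \<subseteq> immediate_basin z0 (f 0) U \<longrightarrow>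
           (\<forall>\<^sub>F n in sequentially. K \<subseteq> immediate_basin z0 (f n) U) \<and>
           uniform_limit K \<phi> (\<phi> 0) sequentially"
proof -
  interpret siegel_linearization "f 0" U z0 "\<phi> 0"
    by unfold_locales (use assms(1-4,11) in auto)
  have \<Theta>: "cos \<Theta> > 0"
    using assms(8) assms(9)[of 1] by (intro cos_gt_zero) auto
  have lim: "(\<lambda>n. deriv (f n) z0) \<longlonglongrightarrow> l"
  proof -
    obtain d where d: "d > 0" "cball z0 d \<subseteq> U" using openU z0U open_contains_cball by blast
    show ?thesis unfolding l_def
    proof (rule deriv_complex_uniform_limit[where A = "ball z0 d"])
      show "uniform_limit (ball z0 d) f (f 0) sequentially"
        by (rule uniform_limit_on_subset[OF assms(7)[of "cball z0 d"]]) (use d in auto)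
      show "\<forall>\<^sub>F n in sequentially. f n holomorphic_on ball z0 d"
        using eventually_ge_at_top[of 1]
        by eventually_elim
           (use d assms(5) ball_subset_cball in \<open>blast intro: holomorphic_on_subset\<close>)
    qed (use d in auto)
  qed
  have near: "\<forall>\<^sub>F n in sequentially. cmod (deriv (f n) z0 - l) < e" if "e > 0" for e
    using tendstoD[OF lim that] by (simp add: dist_norm)
  have main: "\<forall>\<^sub>F n in sequentially. K \<subseteq> immediate_basin z0 (f n) U \<and> (\<forall>z\<in>K. cmod (\<phi> n z - \<phi> 0 z) \<le> \<delta>)"
    if K: "compact K" "K \<subseteq> S" and \<delta>: "\<delta> > 0" for K \<delta>
  proof -
    define c where "c = cos \<Theta> / 2"
    have c: "c > 0" using \<Theta> by (simp add: c_def)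
    obtain D where D: "compact D" "D \<subseteq> U" and ex: "\<forall>M. \<exists>\<eta>>0. \<forall>F \<psi>. F holomorphic_on U \<longrightarrow> F z0 = z0 \<longrightarrow> deriv F z0 \<noteq> l \<longrightarrow>
        cmod (deriv F z0 - l) < \<eta> \<longrightarrow> cmod (deriv F z0) \<le> 1 - c * cmod (deriv F z0 - l) \<longrightarrow>
        (\<forall>z\<in>D. cmod (F z - f 0 z) \<le> M * cmod (deriv F z0 - l)) \<longrightarrow>
        is_koenigs_function F U z0 \<psi> \<longrightarrow>
        K \<subseteq> immediate_basin z0 F U \<and> (\<forall>z\<in>K. cmod (\<psi> z - \<phi> 0 z) \<le> \<delta>)"
      by (rule nearby_koenigs[OF K c \<delta>])
    obtain M where M: "\<And>n z. n \<ge> 1 \<Longrightarrow> z \<in> D \<Longrightarrow> cmod ((f n z - f 0 z) / (deriv (f n) z0 - l)) \<le> M"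
      using assms(10)[OF D] unfolding l_def by blast
    obtain \<eta> where \<eta>: "\<eta> > 0" and \<eta>P: "\<And>F \<psi>. F holomorphic_on U \<Longrightarrow> F z0 = z0 \<Longrightarrow> deriv F z0 \<noteq> l \<Longrightarrow>
        cmod (deriv F z0 - l) < \<eta> \<Longrightarrow> cmod (deriv F z0) \<le> 1 - c * cmod (deriv F z0 - l) \<Longrightarrow>
        (\<forall>z\<in>D. cmod (F z - f 0 z) \<le> M * cmod (deriv F z0 - l)) \<Longrightarrow>
        is_koenigs_function F U z0 \<psi> \<Longrightarrow>
        K \<subseteq> immediate_basin z0 F U \<and> (\<forall>z\<in>K. cmod (\<psi> z - \<phi> 0 z) \<le> \<delta>)"
      using ex by blast
    show ?thesis
      using near[OF \<eta>] near[OF \<Theta>] near[of 1, OF zero_less_one] eventually_ge_at_top[of 1]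
    proof eventually_elim
      case (elim n)
      have att: "f n z0 = z0" "cmod (deriv (f n) z0) < 1"
        using assms(6)[OF elim(4)] by (auto simp: attracting_def fixed_point_def)
      have ne: "deriv (f n) z0 \<noteq> l" using att norm_l by auto
      have "deriv (f n) z0 \<noteq> 0" using elim(3) norm_l by auto
      hence "geometrically_attracting (f n) U z0"
        using assms(6)[OF elim(4)] by (simp add: geometrically_attracting_def)
      hence koe: "is_koenigs_function (f n) U z0 (\<phi> n)" by (rule assms(12)[OF elim(4)])
      show ?case
      proof (rule \<eta>P[OF assms(5)[OF elim(4)] att(1) ne elim(1) _ _ koe])
        show "cmod (deriv (f n) z0) \<le> 1 - c * cmod (deriv (f n) z0 - l)"
          unfolding c_def
          by (rule stolz_angle_contraction[OF norm_l assms(8)])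
             (use assms(9)[OF elim(4)] elim(2) in \<open>auto simp: l_def\<close>)
        show "\<forall>z\<in>D. cmod (f n z - f 0 z) \<le> M * cmod (deriv (f n) z0 - l)"
          using M[OF elim(4)] ne by (auto simp: norm_divide divide_le_eq)
      qed
    qed
  qed
  show ?thesis
  proof (intro allI impI conjI)
    fix K assume "compact K \<and> K \<subseteq> immediate_basin z0 (f 0) U"
    hence K: "compact K" "K \<subseteq> S" by (auto simp: S_def)
    show "\<forall>\<^sub>F n in sequentially. K \<subseteq> immediate_basin z0 (f n) U"
      using main[OF K zero_less_one] by eventually_elim auto
    show "uniform_limit K \<phi> (\<phi> 0) sequentially"
    proof (rule uniform_limitI)
      fix e :: real assume "e > 0"
      hence "e / 2 > 0" by simp
      from main[OF K this] show "\<forall>\<^sub>F n in sequentially. \<forall>z\<in>K. dist (\<phi> n z) (\<phi> 0 z) < e"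
        by eventually_elim (use \<open>e > 0\<close> in \<open>fastforce simp: dist_norm\<close>)
    qed
  qed
qed

end
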